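(* The game $G_5$ has classical value $11/12$ and quantum value $1$. Moreover, no maximally entangled state of any finite dimension admits a perfect strategy for $G_5$: there is no finite-dimensional strategy $(\rho,M,N)$ with $\rho=|\phi\rangle\langle\phi|$ for a maximally entangled unit vector $\phi\in\mathcal H_A\otimes\mathcal H_B$ and $\omega(G_5;\rho,M,N)=1$.
   Context: **The game $G_5$.** Let $e_0,\dots,e_4$ be the standard basis of $\mathbb R^5$ and $D=\mathrm{diag}(2,2,2,2,1)$. Put $c_0=(-e_0-e_1-e_2+e_3)/2$, $c_1=(e_0+e_1-e_2+e_3)/2$, $h=(-e_0+e_1-e_2-e_3)/2$, $h'=(e_0-e_1-e_2-e_3)/2$, $d_0=(-e_0+e_1-e_2+e_3)/2$, $d_1=(e_0+e_1+e_2+e_3)/2$, $k=(e_0+e_1-e_2-e_3)/2$, $k'=(-e_0+e_1+e_2-e_3)/2$. For $x\in\{0,1,2,3\}$ and $a\in\{0,\dots,4\}$ let $u_{xa}$ be the normalization (to unit length) of the $a$-th vector of row $x$: row 0: $(e_0-e_1,\ e_0+e_1,\ e_2-e_3,\ e_2+e_3,\ e_4)$; row 1: $(e_4,\ e_0-e_2,\ e_0+e_2,\ e_1-e_3,\ e_1+e_3)$; row 2: $(e_1-e_2,\ e_1+e_2,\ e_0-e_4,\ e_0+e_4,\ e_3)$; row 3: $(e_0-e_3,\ e_0+e_3,\ e_2-e_4,\ e_2+e_4,\ e_1)$. For $y\in\{0,1,2\}$ and $b\in\{0,\dots,4\}$ let $v_{yb}$ be the normalization of the $b$-th vector of row $y$: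 row 0: $(e_0,e_1,e_2,e_3,e_4)$; row 1: $(c_0,\ c_1,\ h+e_4,\ h-e_4,\ h')$; row 2: $(d_0,\ d_1,\ k+e_4,\ k-e_4,\ k')$. Each of the 12 question pairs $(x,y)$ (Alice gets $x$, Bob gets $y$) has probability $1/12$; answers are $a,b\in\{0,\dots,4\}$; the winning predicate is $\mathsf w(x,y,a,b)=1$ if $u_{xa}^{\mathsf T}Dv_{yb}\neq0$ and $0$ otherwise. **Strategies.** A (finite-dimensional) quantum strategy consists of finite-dimensional complex Hilbert spaces $\mathcal H_A,\mathcal H_B$, a density operator $\rho$ on $\mathcal H_A\otimes\mathcal H_B$, and POVMs $\{M_{a|x}\}_{a=0}^4$ on $\mathcal H_A$ for each $x$ and $\{N_{b|y}\}_{b=0}^4$ on $\mathcal H_B$ for each $y$. Its winning probability is $\omega(G_5;\rho,M,N)=\frac1{12}\sum_{x,y,a,b}\mathsf w(x,y,a,b)\,\mathrm{Tr}[\rho(M_{a|x}\otimes N_{b|y})]$. The quantum value is the supremum of $\omega$ over quantum strategies. The classical value is the maximum winning probability over classical strategies (deterministic answer functions $x\mapsto a(x)$, $y\mapsto b(y)$, possibly mixed by shared randomness). A pure bipartite state is maximally entangled if all its nonzero Schmidt coefficients are equal. *)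

theory Defs
  imports
    "HOL-Probability.Probability_Mass_Function"
    "Jordan_Normal_Form.Schur_Decomposition"
begin

text \<open>
  Finite-dimensional Hilbert spaces are \<open>\<complex>\<^sup>d\<close> with \<open>d\<close> an ordinary natural number, vectors and
  operators being those of \<^theory>\<open>Jordan_Normal_Form.Matrix\<close>; this allows the supremum over
  strategies of all dimensions to be formed.
\<close>

abbreviation std_basis :: "nat \<Rightarrow> real Matrix.vec" where
  "std_basis i \<equiv> unit_vec 5 i"

definition D5 :: "real Matrix.mat" where
  "D5 = mat_diag 5 (\<lambda>i. if i < 4 then 2 else 1)"

text \<open>The half-integral vector \<open>(p e\<^sub>0 + q e\<^sub>1 + r e\<^sub>2 + s e\<^sub>3) / 2\<close>.\<close>

definition half_vec :: "real \<Rightarrow> real \<Rightarrow> real \<Rightarrow> real \<Rightarrow> real Matrix.vec" where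
  "half_vec p q r s = vec_of_list [p / 2, q / 2, r / 2, s / 2, 0]"

definition vec_c0 where "vec_c0 = half_vec (-1) (-1) (-1) 1"
definition vec_c1 where "vec_c1 = half_vec 1 1 (-1) 1"
definition vec_h  where "vec_h  = half_vec (-1) 1 (-1) (-1)"
definition vec_h' where "vec_h' = half_vec 1 (-1) (-1) (-1)"
definition vec_d0 where "vec_d0 = half_vec (-1) 1 (-1) 1"
definition vec_d1 where "vec_d1 = half_vec 1 1 1 1"
definition vec_k  where "vec_k  = half_vec 1 1 (-1) (-1)"
definition vec_k' where "vec_k' = half_vec (-1) 1 1 (-1)"

definition u_rows :: "real Matrix.vec list list" where
  "u_rows =
    [[std_basis 0 - std_basis 1, std_basis 0 + std_basis 1, std_basis 2 - std_basis 3,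
      std_basis 2 + std_basis 3, std_basis 4],
     [std_basis 4, std_basis 0 - std_basis 2, std_basis 0 + std_basis 2,
      std_basis 1 - std_basis 3, std_basis 1 + std_basis 3],
     [std_basis 1 - std_basis 2, std_basis 1 + std_basis 2, std_basis 0 - std_basis 4,
      std_basis 0 + std_basis 4, std_basis 3],
     [std_basis 0 - std_basis 3, std_basis 0 + std_basis 3, std_basis 2 - std_basis 4,
      std_basis 2 + std_basis 4, std_basis 1]]"

definition v_rows :: "real Matrix.vec list list" where
  "v_rows =
    [[std_basis 0, std_basis 1, std_basis 2, std_basis 3, std_basis 4],
     [vec_c0, vec_c1, vec_h + std_basis 4, vec_h - std_basis 4, vec_h'],
     [vec_d0, vec_d1, vec_k + std_basis 4, vec_k - std_basis 4, vec_k']]"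

definition unit_length :: "real Matrix.vec \<Rightarrow> real Matrix.vec" where
  "unit_length v = (1 / sqrt (scalar_prod v v)) \<cdot>\<^sub>v v"

definition u_vec :: "nat \<Rightarrow> nat \<Rightarrow> real Matrix.vec" where
  "u_vec x a = unit_length (u_rows ! x ! a)"

definition v_vec :: "nat \<Rightarrow> nat \<Rightarrow> real Matrix.vec" where
  "v_vec y b = unit_length (v_rows ! y ! b)"

text \<open>Only the arguments \<open>x < 4\<close>, \<open>y < 3\<close>, \<open>a < 5\<close>, \<open>b < 5\<close> are meaningful.\<close>

definition win_pred :: "nat \<Rightarrow> nat \<Rightarrow> nat \<Rightarrow> nat \<Rightarrow> real" where
  "win_pred x y a b = (if scalar_prod (u_vec x a) (D5 *\<^sub>v v_vec y b) \<noteq> 0 then 1 else 0)"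

definition deterministic_winning_prob :: "(nat \<Rightarrow> nat) \<Rightarrow> (nat \<Rightarrow> nat) \<Rightarrow> real" where
  "deterministic_winning_prob f g = 1 / 12 * (\<Sum>x<4. \<Sum>y<3. win_pred x y (f x) (g y))"

text \<open>Shared randomness is represented by its law on pairs of answer functions.\<close>

definition classical_strategy :: "((nat \<Rightarrow> nat) \<times> (nat \<Rightarrow> nat)) pmf \<Rightarrow> bool" where
  "classical_strategy p \<longleftrightarrow> (\<forall>(f, g)\<in>set_pmf p. (\<forall>x<4. f x < 5) \<and> (\<forall>y<3. g y < 5))"

definition classical_winning_prob :: "((nat \<Rightarrow> nat) \<times> (nat \<Rightarrow> nat)) pmf \<Rightarrow> real" where
  "classical_winning_prob p =
    measure_pmf.expectation p (\<lambda>(f, g). deterministic_winning_prob f g)"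

definition is_classical_value :: "real \<Rightarrow> bool" where
  "is_classical_value w \<longleftrightarrow>
    (\<exists>p. classical_strategy p \<and> classical_winning_prob p = w) \<and>
    (\<forall>p. classical_strategy p \<longrightarrow> classical_winning_prob p \<le> w)"

definition mtrace :: "complex Matrix.mat \<Rightarrow> complex" where
  "mtrace A = (\<Sum>i<dim_row A. A $$ (i, i))"

text \<open>The basis vector \<open>e\<^sub>i \<otimes> e\<^sub>j\<close> of \<open>\<complex>\<^sup>m \<otimes> \<complex>\<^sup>n\<close> is the basis vector number \<open>i * n + j\<close> of \<open>\<complex>\<^sup>m\<^sup>n\<close>.\<close>

definition tensor_vec :: "complex Matrix.vec \<Rightarrow> complex Matrix.vec \<Rightarrow> complex Matrix.vec" where
  "tensor_vec a b = Matrix.vec (dim_vec a * dim_vec b)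
    (\<lambda>i. vec_index a (i div dim_vec b) * vec_index b (i mod dim_vec b))"

definition tensor_mat :: "complex Matrix.mat \<Rightarrow> complex Matrix.mat \<Rightarrow> complex Matrix.mat" where
  "tensor_mat A B = Matrix.mat (dim_row A * dim_row B) (dim_col A * dim_col B)
    (\<lambda>(i, j). A $$ (i div dim_row B, j div dim_col B) * B $$ (i mod dim_row B, j mod dim_col B))"

definition ketbra :: "complex Matrix.vec \<Rightarrow> complex Matrix.mat" where
  "ketbra \<phi> = Matrix.mat (dim_vec \<phi>) (dim_vec \<phi>)
    (\<lambda>(i, j). vec_index \<phi> i * cnj (vec_index \<phi> j))"

definition positive_semidefinite :: "nat \<Rightarrow> complex Matrix.mat \<Rightarrow> bool" where
  "positive_semidefinite d A \<longleftrightarrow>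
    A \<in> carrier_mat d d \<and> mat_adjoint A = A \<and>
    (\<forall>x\<in>carrier_vec d. 0 \<le> Re ((A *\<^sub>v x) \<bullet>c x))"

definition density_operator :: "nat \<Rightarrow> complex Matrix.mat \<Rightarrow> bool" where
  "density_operator d \<rho> \<longleftrightarrow> positive_semidefinite d \<rho> \<and> mtrace \<rho> = 1"

definition povm :: "nat \<Rightarrow> nat \<Rightarrow> (nat \<Rightarrow> complex Matrix.mat) \<Rightarrow> bool" where
  "povm d n E \<longleftrightarrow>
    (\<forall>a<n. positive_semidefinite d (E a)) \<and>
    Matrix.mat d d (\<lambda>ij. \<Sum>a<n. E a $$ ij) = 1\<^sub>m d"

text \<open>
  \<open>M x a\<close> and \<open>N y b\<close> are the effects \<open>M\<^bsub>a|x\<^esub>\<close> and \<open>N\<^bsub>b|y\<^esub>\<close>.  The condition on the trace of \<open>\<rho>\<close>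
  excludes \<open>dA = 0\<close> and \<open>dB = 0\<close>.
\<close>

definition quantum_strategy ::
  "nat \<Rightarrow> nat \<Rightarrow> complex Matrix.mat \<Rightarrow> (nat \<Rightarrow> nat \<Rightarrow> complex Matrix.mat)
    \<Rightarrow> (nat \<Rightarrow> nat \<Rightarrow> complex Matrix.mat) \<Rightarrow> bool" where
  "quantum_strategy dA dB \<rho> M N \<longleftrightarrow>
    density_operator (dA * dB) \<rho> \<and> (\<forall>x<4. povm dA 5 (M x)) \<and> (\<forall>y<3. povm dB 5 (N y))"

text \<open>For a quantum strategy the traces are real, so taking the real part loses nothing.\<close>

definition winning_prob ::
  "complex Matrix.mat \<Rightarrow> (nat \<Rightarrow> nat \<Rightarrow> complex Matrix.mat)
    \<Rightarrow> (nat \<Rightarrow> nat \<Rightarrow> complex Matrix.mat) \<Rightarrow> real" where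
  "winning_prob \<rho> M N =
    1 / 12 * (\<Sum>x<4. \<Sum>y<3. \<Sum>a<5. \<Sum>b<5.
      win_pred x y a b * Re (mtrace (\<rho> * tensor_mat (M x a) (N y b))))"

definition quantum_value :: real where
  "quantum_value = Sup {winning_prob \<rho> M N | dA dB \<rho> M N. quantum_strategy dA dB \<rho> M N}"

definition orthonormal_family :: "nat \<Rightarrow> nat \<Rightarrow> (nat \<Rightarrow> complex Matrix.vec) \<Rightarrow> bool" where
  "orthonormal_family d r a \<longleftrightarrow>
    (\<forall>i<r. a i \<in> carrier_vec d) \<and>
    (\<forall>i<r. \<forall>j<r. a i \<bullet>c a j = (if i = j then 1 else 0))"

definition schmidt_decomposition ::
  "nat \<Rightarrow> nat \<Rightarrow> complex Matrix.vec \<Rightarrow> nat \<Rightarrow> (nat \<Rightarrow> real)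
    \<Rightarrow> (nat \<Rightarrow> complex Matrix.vec) \<Rightarrow> (nat \<Rightarrow> complex Matrix.vec) \<Rightarrow> bool" where
  "schmidt_decomposition dA dB \<phi> r s a b \<longleftrightarrow>
    orthonormal_family dA r a \<and> orthonormal_family dB r b \<and> (\<forall>i<r. 0 \<le> s i) \<and>
    \<phi> = Matrix.vec (dA * dB)
      (\<lambda>j. \<Sum>i<r. complex_of_real (s i) * vec_index (tensor_vec (a i) (b i)) j)"

text \<open>
  The nonzero Schmidt coefficients of a state do not depend on the choice of the decomposition, so
  it does not matter which one is used here.
\<close>

definition maximally_entangled :: "nat \<Rightarrow> nat \<Rightarrow> complex Matrix.vec \<Rightarrow> bool" where
  "maximally_entangled dA dB \<phi> \<longleftrightarrow>
    \<phi> \<in> carrier_vec (dA * dB) \<and> \<phi> \<bullet>c \<phi> = 1 \<and>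
    (\<exists>r s a b. schmidt_decomposition dA dB \<phi> r s a b \<and>
      (\<forall>i<r. \<forall>j<r. s i \<noteq> 0 \<longrightarrow> s j \<noteq> 0 \<longrightarrow> s i = s j))"

end

theory Submission
  imports Defs
begin

text \<open>
  In a perfect strategy with a maximally entangled state, compressing the measurements to the
  support of the state (and transposing those of Bob) gives operators \<open>A x a\<close> and \<open>B y b\<close> on a single
  space, with \<open>\<Sum>a. A x a = 1 = \<Sum>b. B y b\<close> and \<open>A x a * B y b = 0 = B y b * A x a\<close> for losing answers.
  These relations are contradictory in every ring without 2-torsion and 3-torsion.  They force the
  question \<open>y = 0\<close> to be answered by orthogonal projections \<open>P i = B 0 i\<close>; off the central projection
  \<open>P 4\<close> the reflections obtained from \<open>P\<close>, from \<open>Q = B 1\<close> and from \<open>R = B 2\<close> form a magic square, which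
  determines the overlaps between their eigenspaces, and these are incompatible with the constraints
  coming from the answers \<open>2\<close> and \<open>3\<close> of the questions \<open>x = 2\<close> and \<open>x = 3\<close>.  Over the reals, the same
  contradiction excludes perfect deterministic strategies.

  The state \<open>\<Sum>i. D\<^sub>i e\<^sub>i \<otimes> e\<^sub>i / \<surd>17\<close> with the measurements in the bases \<open>u\<close> and \<open>v\<close> wins with certainty,
  as the amplitude of the answers \<open>a, b\<close> is \<open>u\<^sub>x\<^sub>a\<^sup>T D v\<^sub>y\<^sub>b / \<surd>17\<close>.
\<close>

section \<open>The winning predicate\<close>

definition u_int :: "int list list list" where
  "u_int =
    [[[1,-1,0,0,0], [1,1,0,0,0], [0,0,1,-1,0], [0,0,1,1,0], [0,0,0,0,1]],
     [[0,0,0,0,1], [1,0,-1,0,0], [1,0,1,0,0], [0,1,0,-1,0], [0,1,0,1,0]],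
     [[0,1,-1,0,0], [0,1,1,0,0], [1,0,0,0,-1], [1,0,0,0,1], [0,0,0,1,0]],
     [[1,0,0,-1,0], [1,0,0,1,0], [0,0,1,0,-1], [0,0,1,0,1], [0,1,0,0,0]]]"

text \<open>Twice the vectors of Bob, to avoid fractions.\<close>

definition v_int :: "int list list list" where
  "v_int =
    [[[2,0,0,0,0], [0,2,0,0,0], [0,0,2,0,0], [0,0,0,2,0], [0,0,0,0,2]],
     [[-1,-1,-1,1,0], [1,1,-1,1,0], [-1,1,-1,-1,2], [-1,1,-1,-1,-2], [1,-1,-1,-1,0]],
     [[-1,1,-1,1,0], [1,1,1,1,0], [1,1,-1,-1,2], [1,1,-1,-1,-2], [-1,1,1,-1,0]]]"

definition D_form :: "int list \<Rightarrow> int list \<Rightarrow> int" where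
  "D_form p q = 2 * (p ! 0 * q ! 0 + p ! 1 * q ! 1 + p ! 2 * q ! 2 + p ! 3 * q ! 3) + p ! 4 * q ! 4"

lemma less_4_cases: "x < (4::nat) \<Longrightarrow> x = 0 \<or> x = 1 \<or> x = 2 \<or> x = 3"
  and less_3_cases: "x < (3::nat) \<Longrightarrow> x = 0 \<or> x = 1 \<or> x = 2"
  and less_5_cases: "x < (5::nat) \<Longrightarrow> x = 0 \<or> x = 1 \<or> x = 2 \<or> x = 3 \<or> x = 4"
  by auto

lemma all_less_5: "(\<forall>i<5. P i) \<longleftrightarrow> P 0 \<and> P 1 \<and> P 2 \<and> P 3 \<and> P (4::nat)"
  using less_5_cases by (auto dest!: less_5_cases)

lemma sum_less_5: "sum f {..<5::nat} = f 0 + f 1 + f 2 + f 3 + (f 4 :: 'a::comm_monoid_add)"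
  by (simp add: eval_nat_numeral add.assoc)

lemma dim_half_vec [simp]: "dim_vec (half_vec p q r s) = 5"
  by (simp add: half_vec_def)

lemma half_vec_index: "i < 5 \<Longrightarrow> vec_index (half_vec p q r s) i = [p / 2, q / 2, r / 2, s / 2, 0] ! i"
  by (simp only: half_vec_def vec_of_list_index)

lemma u_rows_eq:
  assumes "x < 4" "a < 5"
  shows "u_rows ! x ! a = Matrix.vec 5 (\<lambda>i. of_int (u_int ! x ! a ! i))"
proof -
  have "dim_vec (u_rows ! x ! a) = 5 \<and> (\<forall>i<5. vec_index (u_rows ! x ! a) i = of_int (u_int ! x ! a ! i))"
    using less_4_cases[OF assms(1)] less_5_cases[OF assms(2)]
    unfolding all_less_5
    by (elim disjE) (simp_all add: u_rows_def u_int_def)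
  then show ?thesis
    by (intro eq_vecI) auto
qed

lemma v_rows_eq:
  assumes "y < 3" "b < 5"
  shows "v_rows ! y ! b = Matrix.vec 5 (\<lambda>i. of_int (v_int ! y ! b ! i) / 2)"
proof -
  have "dim_vec (v_rows ! y ! b) = 5 \<and> (\<forall>i<5. vec_index (v_rows ! y ! b) i = of_int (v_int ! y ! b ! i) / 2)"
    using less_3_cases[OF assms(1)] less_5_cases[OF assms(2)]
    unfolding all_less_5
    by (elim disjE) (simp_all add: v_rows_def v_int_def half_vec_index vec_c0_def vec_c1_def vec_h_def
      vec_h'_def vec_d0_def vec_d1_def vec_k_def vec_k'_def)
  then show ?thesis
    by (intro eq_vecI) auto
qed

text \<open>Normalization only rescales by positive factors, so the predicate depends on the
  unnormalized vectors alone; the factor \<open>1 / 2\<close> in \<open>form\<close> comes from the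
  doubling in \<open>v_int\<close>. Every winning condition thereby becomes an integer
  computation.\<close>

lemma win_pred_eq:
  assumes "x < 4" "y < 3" "a < 5" "b < 5"
  shows "win_pred x y a b = (if D_form (u_int ! x ! a) (v_int ! y ! b) = 0 then 0 else 1)"
proof -
  let ?u = "u_rows ! x ! a" and ?v = "v_rows ! y ! b"
  have form: "scalar_prod (s \<cdot>\<^sub>v ?u) (D5 *\<^sub>v (t \<cdot>\<^sub>v ?v)) = s * t * of_int (D_form (u_int ! x ! a) (v_int ! y ! b)) / 2" for s t
    unfolding u_rows_eq[OF assms(1,3)] v_rows_eq[OF assms(2,4)]
    by (simp add: scalar_prod_def atLeast0LessThan sum_less_5 D5_def mat_diag_def D_form_def
        field_simps)
  have u: "scalar_prod ?u ?u > 0"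
    unfolding u_rows_eq[OF assms(1,3)] using less_4_cases[OF assms(1)] less_5_cases[OF assms(3)]
    by (elim disjE) (simp_all add: scalar_prod_def atLeast0LessThan sum_less_5 u_int_def)
  have v: "scalar_prod ?v ?v > 0"
    unfolding v_rows_eq[OF assms(2,4)] using less_3_cases[OF assms(2)] less_5_cases[OF assms(4)]
    by (elim disjE) (simp_all add: scalar_prod_def atLeast0LessThan sum_less_5 v_int_def)
  show ?thesis
    using u v by (simp add: win_pred_def u_vec_def v_vec_def unit_length_def form)
qed

section \<open>The operator relations of a perfect strategy\<close>

text \<open>Keeps the index \<open>1\<close> from being rewritten to \<open>Suc 0\<close>, so that
  terms such as \<open>P 1\<close> still match the rules below.\<close>

declare One_nat_def [simp del]

text \<open>\<open>c\<close> is the overlap and \<open>G\<close> the symmetric difference of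
  \<open>E\<close> and \<open>F\<close>: when the product is expanded, the four copies of
  \<open>c\<close> from \<open>E * F\<close> cancel those contained in the summands \<open>E\<close>
  and \<open>F\<close>.\<close>

lemma reflection_mult:
  fixes E F c :: "'a::ring_1"
  assumes "E * F = c" "F * E = c" "E = a + c" "F = c + b" "G = a + b"
  shows "(1 - E - E) * (1 - F - F) = 1 - G - G" "(1 - F - F) * (1 - E - E) = 1 - G - G"
proof -
  have "(1 - E - E) * (1 - F - F) = 1 - E - E - F - F + E * F + E * F + E * F + E * F"
    "(1 - F - F) * (1 - E - E) = 1 - E - E - F - F + F * E + F * E + F * E + F * E"
    by (simp_all add: algebra_simps)
  then show "(1 - E - E) * (1 - F - F) = 1 - G - G" "(1 - F - F) * (1 - E - E) = 1 - G - G"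
    unfolding assms(1,2) unfolding assms(3-5) by simp_all
qed

text \<open>Lets a rule for a two-letter word act inside a longer word that is nested to the
  right.\<close>

lemma mult_extend_right: "x * y = (z::'a::ring_1) \<Longrightarrow> x * (y * w) = z * w"
  by (simp flip: mult.assoc)

text \<open>The ring has no adjoint, hence both orders of multiplication in \<open>lose\<close>; the
  torsion conditions stand in for division by 2 and 3.\<close>

locale game_operators =
  fixes A B :: "nat \<Rightarrow> nat \<Rightarrow> 'a::ring_1"
  assumes sum_A: "x < 4 \<Longrightarrow> (\<Sum>a<5. A x a) = 1"
    and sum_B: "y < 3 \<Longrightarrow> (\<Sum>b<5. B y b) = 1"
    and lose: "x < 4 \<Longrightarrow> y < 3 \<Longrightarrow> a < 5 \<Longrightarrow> b < 5 \<Longrightarrow> win_pred x y a b = 0 \<Longrightarrow>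
      A x a * B y b = 0 \<and> B y b * A x a = 0"
    and torsion2: "z + z = (0::'a) \<Longrightarrow> z = 0"
    and torsion3: "z + z + z = (0::'a) \<Longrightarrow> z = 0"
begin

text \<open>For the questions \<open>x, y\<close>, an answer in \<open>K\<close> wins only against answers in \<open>L\<close>, and conversely.\<close>

definition block :: "nat \<Rightarrow> nat \<Rightarrow> nat set \<Rightarrow> nat set \<Rightarrow> bool" where
  "block x y K L \<longleftrightarrow> x < 4 \<and> y < 3 \<and> K \<subseteq> {..<5} \<and> L \<subseteq> {..<5} \<and>
    (\<forall>a<5. \<forall>b<5. (a \<in> K) \<noteq> (b \<in> L) \<longrightarrow> D_form (u_int ! x ! a) (v_int ! y ! b) = 0)"

lemma block_lose:
  assumes "block x y K L" "a < 5" "b < 5" "(a \<in> K) \<noteq> (b \<in> L)"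
  shows "A x a * B y b = 0" "B y b * A x a = 0"
  using assms lose[of x y a b] by (auto simp: block_def win_pred_eq)

text \<open>For \<open>a\<close> in \<open>K\<close> the answers outside \<open>L\<close> lose, so
  summing over \<open>L\<close> has the same effect as summing over all answers, which gives 1; for
  \<open>a\<close> outside \<open>K\<close> every answer in \<open>L\<close> loses.\<close>

lemma block_A:
  assumes "block x y K L" "a < 5"
  shows "A x a * sum (B y) L = (if a \<in> K then A x a else 0)"
    and "sum (B y) L * A x a = (if a \<in> K then A x a else 0)"
proof -
  have y: "y < 3" and L: "L \<subseteq> {..<5}"
    using assms(1) by (auto simp: block_def)
  note sum_diff = sum.subset_diff[OF L finite_lessThan, of "B y"]
  have *: "a \<in> K \<Longrightarrow> A x a * sum (B y) ({..<5} - L) = 0" "a \<in> K \<Longrightarrow> sum (B y) ({..<5} - L) * A x a = 0"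
    "a \<notin> K \<Longrightarrow> A x a * sum (B y) L = 0" "a \<notin> K \<Longrightarrow> sum (B y) L * A x a = 0"
    using block_lose[OF assms] L
    by (auto simp: sum_distrib_left sum_distrib_right intro!: sum.neutral)
  show "A x a * sum (B y) L = (if a \<in> K then A x a else 0)"
    using * sum_B[OF y] sum_diff by (metis add_0 distrib_left mult.right_neutral)
  show "sum (B y) L * A x a = (if a \<in> K then A x a else 0)"
    using * sum_B[OF y] sum_diff by (metis add_0 distrib_right mult.left_neutral)
qed

text \<open>Inserting \<open>1\<close> as the sum over \<open>A x\<close> leaves exactly the terms
  in \<open>K\<close>. This identity carries operators from Alice to Bob and, through a common
  \<open>x\<close>, from one question of Bob to another.\<close>

lemma block_sum:
  assumes "block x y K L"
  shows "sum (A x) K = sum (B y) L"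
proof -
  have x: "x < 4" and K: "K \<subseteq> {..<5}" using assms by (auto simp: block_def)
  have "sum (B y) L = (\<Sum>a<5. A x a) * sum (B y) L"
    using sum_A[OF x] by simp
  also have "\<dots> = (\<Sum>a<5. if a \<in> K then A x a else 0)"
    using block_A(1)[OF assms] by (simp add: sum_distrib_right)
  also have "\<dots> = sum (A x) K"
    using K by (simp add: sum.If_cases Int_absorb1)
  finally show ?thesis ..
qed

text \<open>By \<open>block_sum\<close> the sum over \<open>L\<close> is also a sum of operators of
  Alice, so the losing relations yield multiplicative relations within a single question of
  Bob.\<close>

lemma block_B:
  assumes "block x y K L" "b < 5"
  shows "B y b * sum (B y) L = (if b \<in> L then B y b else 0)"
    and "sum (B y) L * B y b = (if b \<in> L then B y b else 0)"
proof -
  have x: "x < 4" and K: "K \<subseteq> {..<5}"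
    using assms(1) by (auto simp: block_def)
  note sum_diff = sum.subset_diff[OF K finite_lessThan, of "A x"]
  have *: "b \<in> L \<Longrightarrow> B y b * sum (A x) ({..<5} - K) = 0" "b \<in> L \<Longrightarrow> sum (A x) ({..<5} - K) * B y b = 0"
    "b \<notin> L \<Longrightarrow> B y b * sum (A x) K = 0" "b \<notin> L \<Longrightarrow> sum (A x) K * B y b = 0"
    using block_lose[OF assms(1) _ assms(2)] K
    by (auto simp: sum_distrib_left sum_distrib_right intro!: sum.neutral)
  show "B y b * sum (B y) L = (if b \<in> L then B y b else 0)"
    unfolding block_sum[OF assms(1), symmetric]
    using * sum_A[OF x] sum_diff by (metis add_0 distrib_left mult.right_neutral)
  show "sum (B y) L * B y b = (if b \<in> L then B y b else 0)"
    unfolding block_sum[OF assms(1), symmetric]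
    using * sum_A[OF x] sum_diff by (metis add_0 distrib_right mult.left_neutral)
qed

text \<open>The first six relate the three questions of Bob through \<open>x = 0\<close> and
  \<open>x = 1\<close>; the others isolate the answers 4 and 3 of \<open>y = 0\<close> and split its
  answers along \<open>x = 2\<close> and \<open>x = 3\<close>.\<close>

lemma blocks:
  "block 0 0 {0,1} {0,1}" "block 0 1 {1,2} {0,1}" "block 0 2 {0,2} {0,4}"
  "block 1 0 {1,2} {0,2}" "block 1 1 {1,4} {1,4}" "block 1 2 {2,4} {0,1}"
  "block 0 0 {4} {4}" "block 1 0 {0} {4}" "block 2 0 {4} {3}"
  "block 2 0 {0,1} {1,2}" "block 2 0 {2,3} {0,4}" "block 3 0 {0,1} {0,3}" "block 3 0 {2,3} {2,4}"
  unfolding block_def all_less_5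
  by (simp_all add: D_form_def u_int_def v_int_def)


section \<open>Orthogonality relations among Bob's operators\<close>

abbreviation P where "P \<equiv> B 0"
abbreviation Q where "Q \<equiv> B 1"
abbreviation R where "R \<equiv> B 2"

text \<open>The sum over \<open>L\<close> can be inserted between the two factors: it fixes
  \<open>B y b\<close> and annihilates \<open>B y c\<close>.\<close>

lemma block_separates:
  assumes "block x y K L" "b < 5" "c < 5" "b \<in> L" "c \<notin> L"
  shows "B y b * B y c = 0" "B y c * B y b = 0"
proof -
  have "B y b * B y c = B y b * (sum (B y) L * B y c)" "B y c * B y b = (B y c * sum (B y) L) * B y b"
    unfolding mult.assoc[symmetric, of "B y b"] mult.assoc[of "B y c"]
    using block_B[OF assms(1,2)] assms(4) by simp_all
  then show "B y b * B y c = 0" "B y c * B y b = 0"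
    using block_B[OF assms(1,3)] assms(5) by simp_all
qed

lemma sum_P: "P 0 + P 1 + P 2 + P 3 + P 4 = 1"
  and sum_Q: "Q 0 + Q 1 + Q 2 + Q 3 + Q 4 = 1"
  and sum_R: "R 0 + R 1 + R 2 + R 3 + R 4 = 1"
  using sum_B[of 0] sum_B[of 1] sum_B[of 2] by (simp_all add: sum_less_5)

text \<open>The sets \<open>{0,1}\<close>, \<open>{0,2}\<close> and \<open>{4}\<close> separate any
  two of the five answers.\<close>

lemma P_orth:
  "P 0 * P 1 = 0" "P 0 * P 2 = 0" "P 0 * P 3 = 0" "P 0 * P 4 = 0" "P 1 * P 0 = 0"
  "P 1 * P 2 = 0" "P 1 * P 3 = 0" "P 1 * P 4 = 0" "P 2 * P 0 = 0" "P 2 * P 1 = 0"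
  "P 2 * P 3 = 0" "P 2 * P 4 = 0" "P 3 * P 0 = 0" "P 3 * P 1 = 0" "P 3 * P 2 = 0"
  "P 3 * P 4 = 0" "P 4 * P 0 = 0" "P 4 * P 1 = 0" "P 4 * P 2 = 0" "P 4 * P 3 = 0"
  by (simp_all add: block_separates[OF blocks(1)] block_separates[OF blocks(4)]
      block_separates[OF blocks(7)])

lemma P_idem: "P 0 * P 0 = P 0" "P 1 * P 1 = P 1" "P 2 * P 2 = P 2" "P 3 * P 3 = P 3" "P 4 * P 4 = P 4"
  using block_B(1)[OF blocks(1), of 0] block_B(1)[OF blocks(1), of 1] block_B(1)[OF blocks(4), of 2]
    block_B(1)[OF blocks(9), of 3] block_B(1)[OF blocks(7), of 4]
  by (simp_all add: distrib_left P_orth)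

text \<open>The sets \<open>{0,1}\<close> and \<open>{1,4}\<close> separate the answers 0, 1, 4 from
  each other, but not 2 from 3.\<close>

lemma Q_orth:
  "Q 0 * Q 1 = 0" "Q 0 * Q 4 = 0" "Q 1 * Q 0 = 0" "Q 1 * Q 4 = 0" "Q 4 * Q 0 = 0" "Q 4 * Q 1 = 0"
  by (simp_all add: block_separates[OF blocks(2)] block_separates[OF blocks(5)])

lemma Q_idem: "Q 0 * Q 0 = Q 0" "Q 1 * Q 1 = Q 1" "Q 4 * Q 4 = Q 4"
  using block_B(1)[OF blocks(2), of 0] block_B(1)[OF blocks(2), of 1] block_B(1)[OF blocks(5), of 4]
  by (simp_all add: distrib_left Q_orth)

lemma R_orth:
  "R 0 * R 1 = 0" "R 0 * R 4 = 0" "R 1 * R 0 = 0" "R 1 * R 4 = 0" "R 4 * R 0 = 0" "R 4 * R 1 = 0"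
  by (simp_all add: block_separates[OF blocks(3)] block_separates[OF blocks(6)])

lemma R_idem: "R 0 * R 0 = R 0" "R 1 * R 1 = R 1" "R 4 * R 4 = R 4"
  using block_B(1)[OF blocks(3), of 0] block_B(1)[OF blocks(6), of 1] block_B(1)[OF blocks(3), of 4]
  by (simp_all add: distrib_left R_orth)

section \<open>Reflections attached to the questions of Bob\<close>

definition s where "s = 1 - (P 0 + P 1) - (P 0 + P 1)"
definition s' where "s' = 1 - (P 0 + P 2) - (P 0 + P 2)"
definition t where "t = 1 - (Q 0 + Q 1) - (Q 0 + Q 1)"
definition t' where "t' = 1 - (Q 1 + Q 4) - (Q 1 + Q 4)"

lemma involutions: "s * s = 1" "s' * s' = 1" "t * t = 1" "t' * t' = 1"
  by (simp_all add: s_def s'_def t_def t'_def algebra_simps P_orth P_idem Q_orth Q_idem)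

lemmas involutions' = involutions[THEN mult_extend_right, unfolded mult_1_left]

text \<open>The product of two reflections of one question belongs to the symmetric difference of
  their answer sets, here \<open>{0,1}\<close> and \<open>{0,2}\<close>.\<close>

lemma s_s': "s * s' = 1 - (P 1 + P 2) - (P 1 + P 2)" "s' * s = 1 - (P 1 + P 2) - (P 1 + P 2)"
  by (simp_all add: s_def s'_def algebra_simps P_orth P_idem)

lemma t_t': "t * t' = 1 - (Q 0 + Q 4) - (Q 0 + Q 4)" "t' * t = 1 - (Q 0 + Q 4) - (Q 0 + Q 4)"
  by (simp_all add: t_def t'_def algebra_simps Q_orth Q_idem)

text \<open>The question \<open>x = 0\<close> refines all three questions of Bob: the sums behind
  \<open>s\<close> and \<open>t\<close> overlap in \<open>A 0 1\<close>, and their symmetric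
  difference \<open>A 0 0 + A 0 2\<close> is \<open>R 0 + R 4\<close>.\<close>

lemma s_t: "s * t = 1 - (R 0 + R 4) - (R 0 + R 4)" "t * s = 1 - (R 0 + R 4) - (R 0 + R 4)"
proof -
  have sums: "P 0 + P 1 = A 0 0 + A 0 1" "Q 0 + Q 1 = A 0 1 + A 0 2" "R 0 + R 4 = A 0 0 + A 0 2"
    using block_sum[OF blocks(1)] block_sum[OF blocks(2)] block_sum[OF blocks(3)] by simp_all
  have A: "(P 0 + P 1) * A 0 1 = A 0 1" "(P 0 + P 1) * A 0 2 = 0" "A 0 1 * (P 0 + P 1) = A 0 1" "A 0 2 * (P 0 + P 1) = 0"
    using block_A[OF blocks(1), of 1] block_A[OF blocks(1), of 2] by (simp_all)
  have prods: "(P 0 + P 1) * (Q 0 + Q 1) = A 0 1" "(Q 0 + Q 1) * (P 0 + P 1) = A 0 1"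
    unfolding sums(2) distrib_left[of "P 0 + P 1"] distrib_right[of _ _ "P 0 + P 1"] A by simp_all
  show "s * t = 1 - (R 0 + R 4) - (R 0 + R 4)" "t * s = 1 - (R 0 + R 4) - (R 0 + R 4)"
    unfolding s_def t_def
    by (rule reflection_mult[OF prods], rule sums, rule sums, rule sums)+
qed

text \<open>The same refinement by \<open>x = 1\<close>, with overlap \<open>A 1 1\<close>.\<close>

lemma s'_t': "s' * t' = 1 - (R 0 + R 1) - (R 0 + R 1)" "t' * s' = 1 - (R 0 + R 1) - (R 0 + R 1)"
proof -
  have sums: "P 0 + P 2 = A 1 2 + A 1 1" "Q 1 + Q 4 = A 1 1 + A 1 4" "R 0 + R 1 = A 1 2 + A 1 4"
    using block_sum[OF blocks(4)] block_sum[OF blocks(5)] block_sum[OF blocks(6)] by (simp_all add: add.commute)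
  have A: "(P 0 + P 2) * A 1 1 = A 1 1" "(P 0 + P 2) * A 1 4 = 0" "A 1 1 * (P 0 + P 2) = A 1 1" "A 1 4 * (P 0 + P 2) = 0"
    using block_A[OF blocks(4), of 1] block_A[OF blocks(4), of 4] by (simp_all)
  have prods: "(P 0 + P 2) * (Q 1 + Q 4) = A 1 1" "(Q 1 + Q 4) * (P 0 + P 2) = A 1 1"
    unfolding sums(2) distrib_left[of "P 0 + P 2"] distrib_right[of _ _ "P 0 + P 2"] A by simp_all
  show "s' * t' = 1 - (R 0 + R 1) - (R 0 + R 1)" "t' * s' = 1 - (R 0 + R 1) - (R 0 + R 1)"
    unfolding s'_def t'_def
    by (rule reflection_mult[OF prods], rule sums, rule sums, rule sums)+
qed

lemma s_t_s'_t': "s * t * (s' * t') = 1 - (R 1 + R 4) - (R 1 + R 4)" "s' * t' * (s * t) = 1 - (R 1 + R 4) - (R 1 + R 4)"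
  unfolding s_t s'_t' by (simp_all add: algebra_simps R_orth R_idem)

section \<open>The magic square and its consequences\<close>

lemma A_B_zero:
  assumes "D_form (u_int ! x ! a) (v_int ! y ! b) = 0" "x < 4" "y < 3" "a < 5" "b < 5"
  shows "A x a * B y b = 0" "B y b * A x a = 0"
  using lose[OF assms(2-5)] assms by (simp_all add: win_pred_eq)

text \<open>
  Outside the range of \<open>P 4\<close> the commuting triples \<open>s, t, st\<close> and \<open>s', t', s't'\<close> form a magic square:
  the products \<open>(st)(s't')\<close> and \<open>(ss')(tt')\<close> differ by a sign.
\<close>

lemma magic_square:
  "(1 - P 4) * (s * t * (s' * t')) = - ((1 - P 4) * (s * s' * (t * t')))"
proof -
  have sums: "P 1 + P 2 = A 2 0 + A 2 1" "P 0 + P 3 = A 3 0 + A 3 1"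
    using block_sum[OF blocks(10)] block_sum[OF blocks(12)] by simp_all
  have P4: "1 - P 4 = (P 1 + P 2) + (P 0 + P 3)"
    using sum_P by (simp add: algebra_simps)
  have "A 2 0 * Q 0 = 0" "A 2 0 * Q 4 = 0" "A 2 0 * R 1 = 0" "A 2 0 * R 4 = 0"
    "A 2 1 * Q 1 = 0" "A 2 1 * Q 2 = 0" "A 2 1 * Q 3 = 0" "A 2 1 * R 0 = 0" "A 2 1 * R 2 = 0" "A 2 1 * R 3 = 0"
    "A 3 1 * Q 0 = 0" "A 3 1 * Q 4 = 0" "A 3 0 * R 1 = 0" "A 3 0 * R 4 = 0"
    "A 3 0 * Q 1 = 0" "A 3 0 * Q 2 = 0" "A 3 0 * Q 3 = 0" "A 3 1 * R 0 = 0" "A 3 1 * R 2 = 0" "A 3 1 * R 3 = 0"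
    by (rule A_B_zero; simp add: D_form_def u_int_def v_int_def)+
  note z = this
  \<comment> \<open>Each of these operators loses against the three answers left out, so the sum
    over the remaining two acts on it as the identity.\<close>
  have "A 2 1 * (Q 0 + Q 4) = A 2 1" "A 2 1 * (R 1 + R 4) = A 2 1"
    "A 3 0 * (Q 0 + Q 4) = A 3 0" "A 3 1 * (R 1 + R 4) = A 3 1"
    using arg_cong[OF sum_Q, of "(*) (A 2 1)"] arg_cong[OF sum_R, of "(*) (A 2 1)"]
      arg_cong[OF sum_Q, of "(*) (A 3 0)"] arg_cong[OF sum_R, of "(*) (A 3 1)"]
    by (simp_all add: distrib_left z)
  moreover have "A 2 0 * (Q 0 + Q 4) = 0" "A 2 0 * (R 1 + R 4) = 0" "A 3 1 * (Q 0 + Q 4) = 0" "A 3 0 * (R 1 + R 4) = 0"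
    by (simp_all add: distrib_left z)
  ultimately have q: "(P 1 + P 2) * (Q 0 + Q 4) = A 2 1" "(P 0 + P 3) * (Q 0 + Q 4) = A 3 0"
    and r: "(P 1 + P 2) * (R 1 + R 4) = A 2 1" "(P 0 + P 3) * (R 1 + R 4) = A 3 1"
    unfolding sums distrib_right[of _ _ "Q 0 + Q 4"] distrib_right[of _ _ "R 1 + R 4"] by simp_all
  have p: "(1 - P 4) * (1 - (P 1 + P 2) - (P 1 + P 2)) = (P 0 + P 3) - (P 1 + P 2)"
    unfolding P4 by (simp add: algebra_simps P_orth P_idem)
  \<comment> \<open>The sign arises here: over \<open>E\<close> the sums \<open>q\<close> and
    \<open>r\<close> act alike, while over \<open>F\<close> they are complementary.\<close>
  have gen: "(E + F) * (1 - r - r) = - ((F - E) * (1 - q - q))"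
    if "E * q = c" "F * q = d" "E * r = c" "F * r = F - d" for E F q r c d :: 'a
    using that by (simp add: algebra_simps)
  show ?thesis
    unfolding s_t_s'_t' s_s' t_t' unfolding mult.assoc[symmetric] p
    unfolding P4 by (rule gen[OF q r(1)]) (simp only: r(2), simp add: sums)
qed


text \<open>\<open>P 4\<close> equals both \<open>A 0 4\<close> and \<open>A 1 0\<close>, which lose
  against \<open>Q 0\<close>, \<open>Q 1\<close> and against \<open>Q 1\<close>, \<open>Q 4\<close>
  respectively; so all four reflections act on it as the identity.\<close>

lemma P4_commutes:
  "P 4 * s = P 4" "s * P 4 = P 4" "P 4 * s' = P 4" "s' * P 4 = P 4"
  "P 4 * t = P 4" "t * P 4 = P 4" "P 4 * t' = P 4" "t' * P 4 = P 4"
proof -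
  have A: "P 4 = A 0 4" "P 4 = A 1 0"
    using block_sum[OF blocks(7)] block_sum[OF blocks(8)] by simp_all
  show "P 4 * s = P 4" "s * P 4 = P 4" "P 4 * s' = P 4" "s' * P 4 = P 4"
    by (simp_all add: s_def s'_def algebra_simps P_orth)
  have "P 4 * (Q 0 + Q 1) = 0" "(Q 0 + Q 1) * P 4 = 0"
    unfolding A(1) using block_A[OF blocks(2), of 4] by simp_all
  moreover have "P 4 * (Q 1 + Q 4) = 0" "(Q 1 + Q 4) * P 4 = 0"
    unfolding A(2) using block_A[OF blocks(5), of 0] by simp_all
  ultimately show "P 4 * t = P 4" "t * P 4 = P 4" "P 4 * t' = P 4" "t' * P 4 = P 4"
    unfolding t_def t'_def right_diff_distrib left_diff_distrib by simp_all
qed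

lemma double_cancel: "x + x = y + y \<Longrightarrow> x = (y::'a)"
  using torsion2[of "x - y"] by (simp add: algebra_simps)

lemma anticommute:
  "(1 - P 4) * (s' * t) = - ((1 - P 4) * (t * s'))"
  "(1 - P 4) * (s * t') = - ((1 - P 4) * (t' * s))"
proof -
  define f where "f = 1 - P 4"
  have comm: "f * s = s * f" "f * s' = s' * f" "f * t = t * f" "f * t' = t' * f"
    by (simp_all add: f_def algebra_simps P4_commutes)
  have sq: "f * (s * t * (s' * t')) = - (f * (s * s' * (t * t')))"
    using magic_square by (simp add: f_def)
  \<comment> \<open>Multiplying both words by \<open>s\<close> on the left and by \<open>t'\<close>
    on the right cancels their outer letters.\<close>
  have "s * (f * (s * t * (s' * t'))) * t' = f * (t * s')"
    by (simp add: mult.assoc involutions involutions' comm(1,2)[symmetric] comm(1,2)[symmetric, THEN mult_extend_right])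
  moreover have "s * (f * (s * s' * (t * t'))) * t' = f * (s' * t)"
    by (simp add: mult.assoc involutions involutions' comm(1,2)[symmetric] comm(1,2)[symmetric, THEN mult_extend_right])
  ultimately show "f * (s' * t) = - (f * (t * s'))"
    unfolding sq by (simp, metis minus_minus)
  \<comment> \<open>The same relation with the factors of each product interchanged, which
    \<open>s_t_s'_t'\<close>, \<open>s_s'\<close> and \<open>t_t'\<close> identify with the previous
    one.\<close>
  have sq2: "f * (s' * t' * (s * t)) = - (f * (s' * s * (t' * t)))"
    using sq unfolding s_t_s'_t' s_s' t_t' .
  have "s' * (f * (s' * t' * (s * t))) * t = f * (t' * s)"
    by (simp add: mult.assoc involutions involutions' comm(1,2)[symmetric] comm(1,2)[symmetric, THEN mult_extend_right])
  moreover have "s' * (f * (s' * s * (t' * t))) * t = f * (s * t')"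
    by (simp add: mult.assoc involutions involutions' comm(1,2)[symmetric] comm(1,2)[symmetric, THEN mult_extend_right])
  ultimately show "f * (s * t') = - (f * (t' * s))"
    unfolding sq2 by (simp, metis minus_minus)
qed

text \<open>Off \<open>P 4\<close>, \<open>t\<close> commutes with \<open>s\<close> and anticommutes
  with \<open>s'\<close>, so it preserves \<open>P 0 + P 1\<close> and exchanges
  \<open>P 0 + P 2\<close> with \<open>P 1 + P 3\<close>; products of these sums are single
  projections, so \<open>t\<close> swaps \<open>P 0\<close> with \<open>P 1\<close> and
  \<open>P 2\<close> with \<open>P 3\<close>. Likewise \<open>t'\<close> swaps \<open>P 0\<close>
  with \<open>P 2\<close> and \<open>P 1\<close> with \<open>P 3\<close>.\<close>

lemma shifts:
  "t * P 0 = P 1 * t" "t * P 1 = P 0 * t" "t * P 2 = P 3 * t"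
  "t' * P 0 = P 2 * t'" "t' * P 1 = P 3 * t'" "t' * P 2 = P 0 * t'"
proof -
  define f where "f = 1 - P 4"
  have comm: "f * t = t * f" "f * t' = t' * f"
    by (simp_all add: f_def algebra_simps P4_commutes)
  \<comment> \<open>Anticommutation with \<open>s' = 1 - 2 (P 0 + P 2)\<close>, expanded and
    halved.\<close>
  have "f * t = f * ((P 0 + P 2) * t) + f * (t * (P 0 + P 2))"
    by (rule double_cancel)
      (use anticommute(1)[folded f_def] in \<open>simp add: s'_def algebra_simps\<close>)
  moreover have f: "f * (P 0 + P 2) = P 0 + P 2" "(P 0 + P 2) * f = P 0 + P 2"
     "f * (P 0 + P 1) = P 0 + P 1" "(P 0 + P 1) * f = P 0 + P 1"
    by (simp_all add: f_def algebra_simps P_orth)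
  ultimately have "f * t = (P 0 + P 2) * t + t * (P 0 + P 2)"
    by (simp only: f comm comm[THEN mult_extend_right] mult.assoc f(1,3)[THEN mult_extend_right])
  moreover have f_split: "f = (P 0 + P 2) + (P 1 + P 3)" "f = (P 0 + P 1) + (P 2 + P 3)"
    using sum_P by (simp_all add: f_def algebra_simps)
  then have "f * t = (P 0 + P 2) * t + (P 1 + P 3) * t" "f * t' = (P 0 + P 1) * t' + (P 2 + P 3) * t'"
    by (simp_all only: distrib_right[symmetric])
  note ft = this
  ultimately have a: "t * (P 0 + P 2) = (P 1 + P 3) * t"
    by (simp only: add_left_cancel)
  have "f * t' = f * ((P 0 + P 1) * t') + f * (t' * (P 0 + P 1))"
    by (rule double_cancel)
      (use anticommute(2)[folded f_def] in \<open>simp add: s_def algebra_simps\<close>)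
  then have "f * t' = (P 0 + P 1) * t' + t' * (P 0 + P 1)"
    by (simp only: f comm comm[THEN mult_extend_right] mult.assoc f(1,3)[THEN mult_extend_right])
  then have b: "t' * (P 0 + P 1) = (P 2 + P 3) * t'"
    unfolding ft by (simp only: add_left_cancel)
  have c: "t * (P 0 + P 1) = (P 0 + P 1) * t"
    by (rule double_cancel) (use s_t in \<open>simp add: s_def algebra_simps\<close>)
  have d: "t' * (P 0 + P 2) = (P 0 + P 2) * t'"
    by (rule double_cancel) (use s'_t' in \<open>simp add: s'_def algebra_simps\<close>)
  have prods: "(P 0 + P 2) * (P 0 + P 1) = P 0" "(P 0 + P 1) * (P 0 + P 2) = P 0"
    "(P 1 + P 3) * (P 0 + P 1) = P 1" "(P 2 + P 3) * (P 0 + P 2) = P 2"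
    by (simp_all add: algebra_simps P_orth P_idem)
  have "t * P 0 = (t * (P 0 + P 2)) * (P 0 + P 1)"
    by (simp only: prods mult.assoc)
  also have "\<dots> = P 1 * t"
    by (simp only: a c mult.assoc) (simp only: prods mult.assoc[symmetric])
  finally show 0: "t * P 0 = P 1 * t" .
  show "t * P 1 = P 0 * t" "t * P 2 = P 3 * t"
    using a c 0 by (simp_all add: algebra_simps)
  have "t' * P 0 = (t' * (P 0 + P 1)) * (P 0 + P 2)"
    by (simp only: prods mult.assoc)
  also have "\<dots> = P 2 * t'"
    by (simp only: b d mult.assoc) (simp only: prods mult.assoc[symmetric])
  finally show 0: "t' * P 0 = P 2 * t'" .
  show "t' * P 1 = P 3 * t'" "t' * P 2 = P 0 * t'"
    using b d 0 by (simp_all add: algebra_simps)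
qed

section \<open>Overlaps of the three questions and the contradiction\<close>

lemma sP: "P 0 * s = - P 0" "P 1 * s = - P 1" "P 2 * s = P 2" "P 3 * s = P 3"
    "P 0 * s' = - P 0" "P 1 * s' = P 1" "P 2 * s' = - P 2" "P 3 * s' = P 3"
    "s * P 0 = - P 0" "s * P 1 = - P 1" "s * P 2 = P 2" "s * P 3 = P 3"
    "s' * P 0 = - P 0" "s' * P 1 = P 1" "s' * P 2 = - P 2" "s' * P 3 = P 3"
  by (simp_all add: s_def s'_def algebra_simps P_orth P_idem)

lemmas shift_rules = shifts P_orth P_idem P4_commutes sP
lemmas shift_simps = shift_rules shift_rules[THEN mult_extend_right]

text \<open>The four signs sum to zero on each of the answers 0, 1, 4 and to 4 on the answers 2 and
  3.\<close>

lemma four_Q: "1 + t + t' + t * t' = (Q 2 + Q 2 + Q 2 + Q 2) + (Q 3 + Q 3 + Q 3 + Q 3)"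
  and four_R: "1 + s * t + s' * t' + s * t * (s' * t') = (R 2 + R 2 + R 2 + R 2) + (R 3 + R 3 + R 3 + R 3)"
proof -
  have Q: "Q 3 = 1 - Q 0 - Q 1 - Q 2 - Q 4" and R: "R 3 = 1 - R 0 - R 1 - R 2 - R 4"
    using sum_Q sum_R by (simp_all add: algebra_simps)
  show "1 + t + t' + t * t' = (Q 2 + Q 2 + Q 2 + Q 2) + (Q 3 + Q 3 + Q 3 + Q 3)"
    unfolding t_t' unfolding t_def t'_def Q by (simp add: algebra_simps)
  show "1 + s * t + s' * t' + s * t * (s' * t') = (R 2 + R 2 + R 2 + R 2) + (R 3 + R 3 + R 3 + R 3)"
    unfolding s_t_s'_t' unfolding s_t s'_t' R by (simp add: algebra_simps)
qed

text \<open>By the shifts, \<open>t\<close>, \<open>t'\<close> and \<open>t * t'\<close> move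
  \<open>P 0\<close> to \<open>P 1\<close>, \<open>P 2\<close> and \<open>P 3\<close>, so between
  \<open>P 0\<close> and \<open>P 0\<close> only \<open>1\<close> survives and between
  \<open>P 0\<close> and \<open>P 2\<close> only \<open>t'\<close>; \<open>P 4\<close> is fixed by
  all four terms. In the last equation \<open>s'\<close> contributes the sign.\<close>

lemma overlaps:
  "(P 0 + P 4) * (1 + t + t' + t * t') * (P 0 + P 4) = P 0 + (P 4 + P 4 + P 4 + P 4)"
  "(P 0 + P 4) * (1 + t + t' + t * t') * (P 2 + P 4) = P 0 * t' + (P 4 + P 4 + P 4 + P 4)"
  "(P 0 + P 4) * (1 + s * t + s' * t' + s * t * (s' * t')) * (P 2 + P 4) = - (P 0 * t') + (P 4 + P 4 + P 4 + P 4)"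
  by (simp_all add: ring_distribs mult.assoc shift_simps)

text \<open>
  Sandwiched between the ranges of \<open>P 0\<close> and \<open>P 4\<close>, the projection \<open>Q 2 + Q 3\<close> acts as \<open>1/4\<close> on the
  first and as \<open>1\<close> on the second; this difference forces \<open>A 2 2\<close> to commute with \<open>P 4\<close>.  Comparing the
  constraints from \<open>Q\<close> and \<open>R\<close> then gives \<open>A 2 2 = (P 0 + P 4) / 2\<close>, which annihilates both \<open>Q 2\<close>
  and \<open>Q 3\<close>.
\<close>

lemma no_solution: False
proof -
  define V V' A1 A2 where "V = P 0 + P 4" and "V' = P 2 + P 4" and "A1 = A 2 2" and "A2 = A 3 2"
  define W U where "W = 1 + t + t' + t * t'" and "U = 1 + s * t + s' * t' + s * t * (s' * t')"
  define w2 w3 where "w2 = Q 2 + Q 2 + Q 2 + Q 2" and "w3 = Q 3 + Q 3 + Q 3 + Q 3"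
  define r2 r3 where "r2 = R 2 + R 2 + R 2 + R 2" and "r3 = R 3 + R 3 + R 3 + R 3"
  define z where "z = P 4 + P 4 + P 4 + P 4"
  note ov = overlaps[folded V_def V'_def W_def U_def z_def]
  have W: "W = w2 + w3" and U: "U = r2 + r3"
    by (simp_all only: W_def U_def w2_def w3_def r2_def r3_def four_Q four_R)
  have split: "V = A1 + A 2 3" "V' = A2 + A 3 3"
    unfolding V_def V'_def A1_def A2_def using block_sum[OF blocks(11)] block_sum[OF blocks(13)] by simp_all
  have V: "A1 * V = A1" "V * A1 = A1" "A2 * V' = A2" "V' * A2 = A2"
    unfolding V_def V'_def A1_def A2_def using block_A[OF blocks(11), of 2] block_A[OF blocks(13), of 2] by simp_all
  have "A 2 2 * Q 3 = 0" "A 2 3 * Q 2 = 0" "A 2 2 * R 2 = 0" "A 2 3 * R 3 = 0"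
    "Q 3 * A 2 2 = 0" "Q 2 * A 2 3 = 0"
    "Q 3 * A 3 2 = 0" "Q 2 * A 3 3 = 0" "R 3 * A 3 2 = 0" "R 2 * A 3 3 = 0"
    by (rule A_B_zero; simp add: D_form_def u_int_def v_int_def)+
  then have z: "A1 * w3 = 0" "V * w2 = A1 * w2" "A1 * r2 = 0" "V * r3 = A1 * r3"
    "w3 * A1 = 0" "w2 * V = w2 * A1"
    "w3 * A2 = 0" "w2 * V' = w2 * A2" "r3 * A2 = 0" "r2 * V' = r2 * A2"
    unfolding split by (simp_all add: A1_def A2_def w2_def w3_def r2_def r3_def ring_distribs)
  have AW: "A1 * W = V * w2" "W * A1 = w2 * V" "W * A2 = w2 * V'" "A1 * U = V * r3" "U * A2 = r2 * V'"
    unfolding W U by (simp_all add: z ring_distribs)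
  \<comment> \<open>\<open>A1\<close> selects \<open>w2\<close> from \<open>W\<close> on either
    side, so it commutes with \<open>V * W * V\<close>.\<close>
  have "A1 * (V * W * V) = V * w2 * V" "(V * W * V) * A1 = V * w2 * V"
    by (simp only: mult.assoc[symmetric] V AW) (simp only: mult.assoc V AW)
  then have comm: "A1 * (P 0 + z) = (P 0 + z) * A1"
    unfolding ov by simp
  have "A1 * (V * W * V') = V * w2 * V'" "(V * W * V') * A2 = V * w2 * V'"
    by (simp only: mult.assoc[symmetric] V AW) (simp only: mult.assoc V AW)
  then have WA: "A1 * (P 0 * t' + z) = (P 0 * t' + z) * A2"
    unfolding ov by simp
  \<comment> \<open>For \<open>R\<close> the selection is crossed: \<open>A1\<close> selects
    \<open>r3\<close> from the left and \<open>A2\<close> selects \<open>r2\<close> from the right,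
    so the two products add up to \<open>V * U * V'\<close> instead of being equal.\<close>
  have "A1 * (V * U * V') = V * r3 * V'" "(V * U * V') * A2 = V * r2 * V'"
    by (simp only: mult.assoc[symmetric] V AW) (simp only: mult.assoc V AW)
  moreover have "V * U * V' = V * r2 * V' + V * r3 * V'"
    unfolding U by (simp add: ring_distribs)
  ultimately have UA: "A1 * (- (P 0 * t') + z) + (- (P 0 * t') + z) * A2 = - (P 0 * t') + z"
    unfolding ov by simp
  \<comment> \<open>In \<open>P 0 + z\<close> the weights of \<open>P 0\<close> and
    \<open>P 4\<close> are 1 and 4; commutation forces three times the off-diagonal corner to
    vanish.\<close>
  have P04: "P 0 * A1 * P 4 = 0"
  proof (rule torsion3)
    have "P 0 * (A1 * (P 0 + z)) * P 4 = P 0 * ((P 0 + z) * A1) * P 4"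
      by (simp only: comm)
    then show "P 0 * A1 * P 4 + P 0 * A1 * P 4 + P 0 * A1 * P 4 = 0"
      by (simp add: z_def ring_distribs mult.assoc shift_simps)
  qed
  have P40: "P 4 * A1 * P 0 = 0"
  proof (rule torsion3)
    have "P 4 * (A1 * (P 0 + z)) * P 0 = P 4 * ((P 0 + z) * A1) * P 0"
      by (simp only: comm)
    then show "P 4 * A1 * P 0 + P 4 * A1 * P 0 + P 4 * A1 * P 0 = 0"
      by (simp add: z_def ring_distribs mult.assoc shift_simps)
  qed
  have z_rules: "P 4 * z = z" "P 0 * z = 0" "P 0 * (A1 * z) = 0"
    using P04 by (simp_all add: z_def distrib_left shift_simps mult.assoc)
  have "P 4 * A1 * V = V * A1 * P 4" "P 0 * A1 * V = V * A1 * P 0"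
    unfolding V_def by (simp_all add: ring_distribs P04 P40)
  then have P4A: "P 4 * A1 = A1 * P 4" and P0A: "P 0 * A1 = A1 * P 0"
    by (simp_all only: V mult.assoc[of _ A1 V])
  have P4z: "P 4 * (A1 * z) = A1 * z"
    by (simp add: P4A[THEN mult_extend_right] mult.assoc z_rules)
  have P4Pt: "P 4 * (A1 * (P 0 * t')) = 0" "P 0 * (A1 * (P 0 * t')) = A1 * (P 0 * t')"
    by (simp_all add: P4A[THEN mult_extend_right] P0A[THEN mult_extend_right] mult.assoc shift_simps)
  \<comment> \<open>After multiplication by \<open>P 4\<close>, \<open>WA\<close> says that
    \<open>A1 * z\<close> and \<open>z * A2\<close> agree and \<open>UA\<close> that they add up to
    \<open>z\<close>; hence each is half of \<open>z\<close>.\<close>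
  have A4: "A1 * P 4 + A1 * P 4 = P 4"
  proof -
    have "A1 * z = z * A2"
      using arg_cong[OF WA, of "(*) (P 4)"]
      by (simp add: ring_distribs mult.assoc P4z P4Pt shift_simps z_rules[THEN mult_extend_right])
    moreover have "A1 * z + z * A2 = z"
      using arg_cong[OF UA, of "(*) (P 4)"]
      by (simp add: ring_distribs mult.assoc P4z P4Pt shift_simps z_rules z_rules[THEN mult_extend_right])
    ultimately have "A1 * z + A1 * z = z"
      by simp
    then have "((A1 * P 4 + A1 * P 4) + (A1 * P 4 + A1 * P 4)) + ((A1 * P 4 + A1 * P 4) + (A1 * P 4 + A1 * P 4)) =
        (P 4 + P 4) + (P 4 + P 4)"
      by (simp add: z_def ring_distribs add.assoc)
    then show ?thesis
      by (rule double_cancel[OF double_cancel])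
  qed
  \<comment> \<open>As for \<open>P 4\<close>, with the common sign in \<open>UA\<close> cancelled;
    the factor \<open>t'\<close> is then removed by \<open>t' * t' = 1\<close>.\<close>
  have A0: "A1 * P 0 + A1 * P 0 = P 0"
  proof -
    have "A1 * (P 0 * t') = P 0 * (t' * A2)"
      using arg_cong[OF WA, of "(*) (P 0)"]
      by (simp add: ring_distribs mult.assoc P4Pt shift_simps z_rules z_rules[THEN mult_extend_right])
    moreover have "A1 * (P 0 * t') + P 0 * (t' * A2) = P 0 * t'"
      using arg_cong[OF UA, of "(*) (P 0)"]
      by (simp add: ring_distribs mult.assoc P4Pt shift_simps z_rules z_rules[THEN mult_extend_right])
        (simp add: algebra_simps)
    ultimately have "(A1 * (P 0 * t') + A1 * (P 0 * t')) * t' = P 0 * t' * t'"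
      by simp
    then show ?thesis
      by (simp add: ring_distribs mult.assoc involutions)
  qed
  have "A1 + A1 = A1 * V + A1 * V"
    by (simp add: V)
  also have "\<dots> = V"
    using A0 A4 by (simp add: V_def ring_distribs algebra_simps)
  finally have AV: "A1 + A1 = V" .
  have Vw3: "V * w3 = 0"
    unfolding AV[symmetric] by (simp add: ring_distribs z)
  \<comment> \<open>Substituting \<open>V = A1 + A1\<close> into \<open>V * w2 = A1 * w2\<close>
    shows that \<open>V * w2\<close> is its own double, hence zero.\<close>
  have "V * w2 + V * w2 = V * w2"
    using AV by (metis distrib_right z(2))
  then have "V * W = 0"
    using Vw3 by (simp add: W ring_distribs)
  then have eq: "P 0 + z = 0"
    using ov(1) by simp
  have P0: "P 0 = 0"
    using arg_cong[OF eq, of "(*) (P 0)"] by (simp add: z_def ring_distribs shift_simps)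
  have "(P 4 + P 4) + (P 4 + P 4) = 0"
    using eq by (simp add: P0 z_def add.assoc)
  then have P4: "P 4 = 0"
    by (rule torsion2[OF torsion2])
  \<comment> \<open>The shifts carry the vanishing of \<open>P 0\<close> to the other
    projections.\<close>
  have "P 1 * t * t = 0" "P 2 * t' * t' = 0"
    unfolding shifts(1,4)[symmetric] P0 by simp_all
  then have P12: "P 1 = 0" "P 2 = 0"
    by (simp_all add: mult.assoc involutions)
  have "P 3 * t * t = 0"
    unfolding shifts(3)[symmetric] P12 by simp
  then have "P 3 = 0"
    by (simp add: mult.assoc involutions)
  then show False
    using sum_P by (simp add: P0 P4 P12)
qed

end

section \<open>The classical value\<close>

lemma win_pred_bounds: "0 \<le> win_pred x y a b" "win_pred x y a b \<le> 1"
  by (simp_all add: win_pred_def)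

text \<open>If no question pair were lost, the 0/1 indicators of the answers would satisfy the
  operator relations in the ring of reals.\<close>

lemma no_perfect_answers:
  assumes f: "\<And>x. x < 4 \<Longrightarrow> f x < 5" and g: "\<And>y. y < 3 \<Longrightarrow> g y < 5"
  shows "\<exists>x<4. \<exists>y<3. win_pred x y (f x) (g y) = 0"
proof (rule ccontr)
  assume "\<not> ?thesis"
  then interpret game_operators "\<lambda>x a. if a = f x then 1 else (0::real)" "\<lambda>y b. if b = g y then 1 else (0::real)"
    by unfold_locales (auto simp: f g)
  show False
    by (rule no_solution)
qed

lemma deterministic_le:
  assumes "\<And>x. x < 4 \<Longrightarrow> f x < 5" and "\<And>y. y < 3 \<Longrightarrow> g y < 5"
  shows "deterministic_winning_prob f g \<le> 11 / 12"
proof -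
  obtain x y where xy: "x < 4" "y < 3" "win_pred x y (f x) (g y) = 0"
    using no_perfect_answers[of f g] assms by blast
  let ?w = "\<lambda>(x, y). win_pred x y (f x) (g y)" and ?X = "{..<4::nat} \<times> {..<3::nat}"
  have "(\<Sum>x<4. \<Sum>y<3. win_pred x y (f x) (g y)) = sum ?w ?X"
    by (simp add: sum.cartesian_product)
  also have "\<dots> = sum ?w (?X - {(x, y)})"
    using xy by (subst sum.remove[of _ "(x, y)"]) auto
  also have "\<dots> \<le> of_nat (card (?X - {(x, y)})) * 1"
    by (rule sum_bounded_above) (auto simp: win_pred_bounds)
  also have "card (?X - {(x, y)}) = 11"
    using xy by (subst card_Diff_singleton) auto
  finally show ?thesis
    by (simp add: deterministic_winning_prob_def)
qed

lemma classical_value: "is_classical_value (11 / 12)"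
  unfolding is_classical_value_def
proof (intro conjI exI allI impI)
  \<comment> \<open>These answers lose only at \<open>x = 0\<close>, \<open>y = 1\<close>, where the
    chosen vectors are \<open>e_0 - e_1\<close> and \<open>c_0\<close>.\<close>
  let ?f = "\<lambda>x::nat. if x = 1 \<or> x = 2 then 2 else 0::nat" and ?g = "\<lambda>y::nat. 0::nat"
  have "deterministic_winning_prob ?f ?g = 11 / 12"
    by (simp add: deterministic_winning_prob_def win_pred_eq D_form_def u_int_def v_int_def
      lessThan_nat_numeral lessThan_Suc)
  then show "classical_winning_prob (return_pmf (?f, ?g)) = 11 / 12"
    by (simp add: classical_winning_prob_def)
  show "classical_strategy (return_pmf (?f, ?g))"
    by (auto simp: classical_strategy_def)
next
  fix p
  assume p: "classical_strategy p"
  have bound: "deterministic_winning_prob f g \<le> 11 / 12" if "(f, g) \<in> set_pmf p" for f g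
    using p that by (intro deterministic_le) (auto simp: classical_strategy_def)
  have "0 \<le> deterministic_winning_prob f g" for f g
    by (auto simp: deterministic_winning_prob_def intro!: sum_nonneg win_pred_bounds)
  with bound have "AE z in measure_pmf p. norm (case z of (f, g) \<Rightarrow> deterministic_winning_prob f g) \<le> 11 / 12"
    by (auto simp: AE_measure_pmf_iff)
  then have "integrable (measure_pmf p) (\<lambda>(f, g). deterministic_winning_prob f g)"
    by (intro measure_pmf.integrable_const_bound[where B = "11 / 12"]) auto
  then show "classical_winning_prob p \<le> 11 / 12"
    unfolding classical_winning_prob_def
    by (intro measure_pmf.integral_le_const) (auto simp: AE_measure_pmf_iff dest: bound)
qed

section \<open>Positive semidefinite matrices and winning probabilities\<close>

lemma sum_div_mod:
  fixes g :: "nat \<Rightarrow> nat \<Rightarrow> 'b::comm_monoid_add"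
  shows "(\<Sum>p<m * n. g (p div n) (p mod n)) = (\<Sum>i<m. \<Sum>j<n. g i j)"
proof (cases "n = 0")
  case False
  have "(\<Sum>p<m * n. g (p div n) (p mod n)) = (\<Sum>i<m. \<Sum>p = i * n..<i * n + n. g (p div n) (p mod n))"
    by (rule sum.nat_group[symmetric])
  also have "\<dots> = (\<Sum>i<m. \<Sum>j<n. g i j)"
  proof (rule sum.cong[OF refl])
    fix i
    have "(\<Sum>p = i * n..<i * n + n. g (p div n) (p mod n)) = (\<Sum>j = 0..<n. g ((j + i * n) div n) ((j + i * n) mod n))"
      using sum.shift_bounds_nat_ivl[of "\<lambda>p. g (p div n) (p mod n)" 0 "i * n" n] by (simp add: add.commute)
    also have "\<dots> = (\<Sum>j<n. g i j)"
      using False by (intro sum.cong) auto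
    finally show "(\<Sum>p = i * n..<i * n + n. g (p div n) (p mod n)) = (\<Sum>j<n. g i j)" .
  qed
  finally show ?thesis .
qed simp

text \<open>Cholesky factorization by induction on the size: a zero last pivot forces the last row
  to vanish, and otherwise the Schur complement is again positive.\<close>

lemma psd_factorization:
  fixes f :: "nat \<Rightarrow> nat \<Rightarrow> complex"
  assumes "\<And>i j. i < n \<Longrightarrow> j < n \<Longrightarrow> f j i = cnj (f i j)"
    and "\<And>x. 0 \<le> Re (\<Sum>i<n. \<Sum>j<n. cnj (x i) * f i j * x j)"
  shows "\<exists>L. \<forall>i<n. \<forall>j<n. f i j = (\<Sum>k<n. L i k * cnj (L j k))"
  using assms
proof (induction n arbitrary: f)
  case (Suc n)
  note herm = Suc.prems(1) and pos = Suc.prems(2)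
  let ?form = "\<lambda>f n x. \<Sum>i<n. \<Sum>j<n. cnj (x i) * f i j * x j"
  have form_Suc: "?form f (Suc n) (x(n := c)) = ?form f n x + cnj c * (\<Sum>j<n. f n j * x j) +
      cnj (\<Sum>j<n. f n j * x j) * c + cnj c * f n n * c" for x c
  proof -
    have "(\<Sum>i<n. cnj (x i) * f i n * c) = cnj (\<Sum>j<n. f n j * x j) * c"
      unfolding cnj_sum sum_distrib_right
    proof (intro sum.cong refl)
      fix i assume "i \<in> {..<n}"
      then have "f i n = cnj (f n i)"
        using herm[of n i] by simp
      then show "cnj (x i) * f i n * c = cnj (f n i * x i) * c"
        by simp
    qed
    then show ?thesis
      by (simp add: sum.distrib sum_distrib_left mult.assoc add_ac)
  qed
  have d_real: "f n n = of_real (Re (f n n))"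
    using herm[of n n] by (simp add: complex_eq_iff)
  have d_pos: "0 \<le> Re (f n n)"
    using pos[of "(\<lambda>_. 0)(n := 1)"] unfolding form_Suc by simp
  show ?case
  proof (cases "Re (f n n) = 0")
    case True
    have zero: "f n i = 0" if "i < n" for i
    proof (rule ccontr)
      assume "f n i \<noteq> 0"
      define w where "w = (cmod (f n i))\<^sup>2"
      have w: "w > 0" using \<open>f n i \<noteq> 0\<close> by (simp add: w_def)
      \<comment> \<open>Chosen so that the real part of the form is -1 at the test vector with entry
        1 at \<open>i\<close> and \<open>r * f n i\<close> at \<open>n\<close>.\<close>
      define r where "r = - (Re (f i i) + 1) / (2 * w)"
      have row: "(\<Sum>j<n. f n j * (if j = i then 1 else 0)) = f n i"
        using that by (simp add: if_distrib cong: if_cong)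
      have "?form f n (\<lambda>j. if j = i then 1 else 0) =
          (\<Sum>k<n. \<Sum>j<n. if j = i then (if k = i then f i i else 0) else 0)"
        by (intro sum.cong) auto
      then have diag: "?form f n (\<lambda>j. if j = i then 1 else 0) = f i i"
        using that by simp
      have w': "cnj (f n i) * f n i = of_real w" "f n i * cnj (f n i) = of_real w"
        unfolding w_def complex_norm_square by (simp_all add: mult.commute)
      have "Re (?form f (Suc n) ((\<lambda>j. if j = i then 1 else 0)(n := of_real r * f n i))) = Re (f i i) + 2 * r * w"
        unfolding form_Suc row diag using True d_real
        by (simp add: w'[unfolded mult.commute[of _ "f n i"]] mult_ac flip: of_real_mult)
      moreover have "\<dots> < 0"
        using w by (simp add: r_def field_simps)
      ultimately show False
        using pos[of "(\<lambda>j. if j = i then 1 else 0)(n := of_real r * f n i)"] by simp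
    qed
    have "0 \<le> Re (?form f n x)" for x
      using pos[of "x(n := 0)"] unfolding form_Suc by simp
    then have "\<exists>L. \<forall>i<n. \<forall>j<n. f i j = (\<Sum>k<n. L i k * cnj (L j k))"
      by (intro Suc.IH herm less_SucI)
    then obtain L where L: "\<forall>i<n. \<forall>j<n. f i j = (\<Sum>k<n. L i k * cnj (L j k))"
      by blast
    have "f i n = 0" if "i \<le> n" for i
      using zero[of i] herm[of n i] that d_real True by (cases "i = n") auto
    moreover have "f n i = 0" if "i \<le> n" for i
      using zero[of i] that d_real True by (cases "i = n") auto
    ultimately show ?thesis
      using L by (intro exI[of _ "\<lambda>i k. if i = n \<or> k = n then 0 else L i k"])
        (auto simp: less_Suc_eq)
  next
    case False
    define d where "d = Re (f n n)"
    have d: "d > 0" "f n n = of_real d"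
      using False d_pos d_real by (auto simp: d_def)
    \<comment> \<open>The Schur complement of the pivot \<open>f n n\<close>.\<close>
    define g where "g i j = f i j - f i n * f n j / of_real d" for i j
    have g_herm: "g j i = cnj (g i j)" if "i < n" "j < n" for i j
      using that herm[of i j] herm[of i n] herm[of n j] by (simp add: g_def)
    have g_form: "?form g n x = ?form f n x - cnj (\<Sum>j<n. f n j * x j) * (\<Sum>j<n. f n j * x j) / of_real d" for x
    proof -
      have row: "cnj (\<Sum>j<n. f n j * x j) = (\<Sum>i<n. cnj (x i) * f i n)"
        unfolding cnj_sum using herm[of n] by (intro sum.cong) auto
      have "cnj (\<Sum>j<n. f n j * x j) * (\<Sum>j<n. f n j * x j) / of_real d =
          (\<Sum>i<n. \<Sum>j<n. cnj (x i) * (f i n * f n j / of_real d) * x j)"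
        unfolding row sum_product sum_divide_distrib by (intro sum.cong refl) simp
      then show ?thesis
        by (simp only: g_def right_diff_distrib left_diff_distrib sum_subtractf)
    qed
    have "0 \<le> Re (?form g n x)" for x
    proof -
      let ?y = "\<Sum>j<n. f n j * x j"
      have "b + cnj (- y / of_real d) * y + cnj y * (- y / of_real d) + cnj (- y / of_real d) * of_real d * (- y / of_real d) =
          b - cnj y * y / of_real d" for b y :: complex
        using d(1) by (simp add: field_simps)
      \<comment> \<open>This last coordinate completes the square, which reduces the form of
        \<open>f\<close> to that of \<open>g\<close>.\<close>
      then have "?form f (Suc n) (x(n := - ?y / of_real d)) = ?form g n x"
        unfolding form_Suc g_form d(2) .
      then show ?thesis
        using pos[of "x(n := - ?y / of_real d)"] by (simp only:)
    qed
    then obtain L where L: "\<forall>i<n. \<forall>j<n. g i j = (\<Sum>k<n. L i k * cnj (L j k))"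
      using Suc.IH[of g] g_herm by blast
    \<comment> \<open>Column \<open>n\<close> holds the scaled pivot column; the other columns are
      those of \<open>L\<close>, with zeros in row \<open>n\<close>.\<close>
    define L' where "L' i k = (if k = n then f i n / of_real (sqrt d) else if i = n then 0 else L i k)" for i k
    have sq: "complex_of_real (sqrt d) * of_real (sqrt d) = of_real d"
      using d by (simp flip: of_real_mult)
    have "f i j = (\<Sum>k<Suc n. L' i k * cnj (L' j k))" if "i < Suc n" "j < Suc n" for i j
    proof -
      have *: "f i n / of_real (sqrt d) * cnj (f j n / of_real (sqrt d)) = f i n * f n j / of_real d"
        using herm[of j n] that by (simp add: sq)
      have "(\<Sum>k<n. L' i k * cnj (L' j k)) = (if i < n \<and> j < n then g i j else 0)"
        using L that by (auto simp: L'_def less_Suc_eq)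
      moreover have "(\<Sum>k<Suc n. L' i k * cnj (L' j k)) = (\<Sum>k<n. L' i k * cnj (L' j k)) + f i n * f n j / of_real d"
        unfolding *[symmetric] by (simp add: L'_def)
      ultimately have "(\<Sum>k<Suc n. L' i k * cnj (L' j k)) = (if i < n \<and> j < n then g i j else 0) + f i n * f n j / of_real d"
        by simp
      then show ?thesis
        using that d by (auto simp: g_def less_Suc_eq)
    qed
    then show ?thesis by blast
  qed
qed simp

lemma index_mat_adjoint:
  assumes "A \<in> carrier_mat d d" "i < d" "j < d"
  shows "mat_adjoint A $$ (i, j) = cnj (A $$ (j, i))"
  using assms by (simp add: mat_adjoint_def mat_of_rows_def)

lemma positive_semidefinite_factor:
  assumes "positive_semidefinite d A"
  obtains L where "\<And>i j. i < d \<Longrightarrow> j < d \<Longrightarrow> A $$ (i, j) = (\<Sum>k<d. L i k * cnj (L j k))"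
proof -
  have A: "A \<in> carrier_mat d d" and adj: "mat_adjoint A = A"
    and pos: "\<And>x. x \<in> carrier_vec d \<Longrightarrow> 0 \<le> Re ((A *\<^sub>v x) \<bullet>c x)"
    using assms by (auto simp: positive_semidefinite_def)
  have "A $$ (j, i) = cnj (A $$ (i, j))" if "i < d" "j < d" for i j
    using index_mat_adjoint[OF A that(2,1)] adj by simp
  moreover have "0 \<le> Re (\<Sum>i<d. \<Sum>j<d. cnj (x i) * A $$ (i, j) * x j)" for x
  proof -
    have "(A *\<^sub>v Matrix.vec d x) \<bullet>c Matrix.vec d x = (\<Sum>i<d. \<Sum>j<d. cnj (x i) * A $$ (i, j) * x j)"
      using A by (auto simp: scalar_prod_def atLeast0LessThan sum_distrib_left sum_distrib_right mult_ac intro!: sum.cong)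
    then show ?thesis
      using pos[of "Matrix.vec d x"] by simp
  qed
  ultimately show ?thesis
    using psd_factorization[of d "\<lambda>i j. A $$ (i, j)"] that by blast
qed

lemma positive_semidefinite_ketbra:
  "v \<in> carrier_vec d \<Longrightarrow> positive_semidefinite d (ketbra v)"
  unfolding positive_semidefinite_def
proof (intro conjI ballI)
  assume v: "v \<in> carrier_vec d"
  show A: "ketbra v \<in> carrier_mat d d"
    using v by (simp add: ketbra_def)
  show "mat_adjoint (ketbra v) = ketbra v"
  proof (rule eq_matI)
    fix i j assume "i < dim_row (ketbra v)" "j < dim_col (ketbra v)"
    then have "i < d" "j < d" using A by auto
    then show "mat_adjoint (ketbra v) $$ (i, j) = ketbra v $$ (i, j)"
      using v by (simp add: index_mat_adjoint[OF A]) (simp add: ketbra_def)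
  qed (use A in \<open>simp_all add: mat_adjoint_def\<close>)
  fix x :: "complex Matrix.vec" assume x: "x \<in> carrier_vec d"
  have "(ketbra v *\<^sub>v x) \<bullet>c x = (\<Sum>i<d. \<Sum>j<d. (v $ i * cnj (x $ i)) * cnj (v $ j * cnj (x $ j)))"
    using v x by (auto simp: ketbra_def scalar_prod_def atLeast0LessThan sum_distrib_left sum_distrib_right mult_ac intro!: sum.cong)
  also have "\<dots> = of_real ((cmod (\<Sum>i<d. v $ i * cnj (x $ i)))\<^sup>2)"
    by (simp only: complex_norm_square cnj_sum sum_product)
  finally show "0 \<le> Re ((ketbra v *\<^sub>v x) \<bullet>c x)"
    by simp
qed

text \<open>Expanding both factorizations turns the trace into a sum of squared moduli, which is
  nonnegative and vanishes only if every overlap does.\<close>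

lemma trace_of_factors:
  assumes "\<And>p q. p < d \<Longrightarrow> q < d \<Longrightarrow> \<rho> $$ (p, q) = (\<Sum>m\<in>I. w p m * cnj (w q m))"
    and "\<And>p q. p < d \<Longrightarrow> q < d \<Longrightarrow> T $$ (p, q) = (\<Sum>n\<in>J. z p n * cnj (z q n))"
    and "\<rho> \<in> carrier_mat d d" "T \<in> carrier_mat d d"
  shows "mtrace (\<rho> * T) = of_real (\<Sum>m\<in>I. \<Sum>n\<in>J. (cmod (\<Sum>p<d. w p m * cnj (z p n)))\<^sup>2)"
proof -
  have "mtrace (\<rho> * T) = (\<Sum>p<d. \<Sum>q<d. \<rho> $$ (p, q) * T $$ (q, p))"
    using assms(3,4) by (auto simp: mtrace_def scalar_prod_def atLeast0LessThan intro!: sum.cong)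
  also have "\<dots> = (\<Sum>p<d. \<Sum>q<d. \<Sum>m\<in>I. \<Sum>n\<in>J. (w p m * cnj (z p n)) * cnj (w q m * cnj (z q n)))"
    by (intro sum.cong refl) (simp add: assms(1,2) sum_product mult_ac)
  also have "\<dots> = (\<Sum>m\<in>I. \<Sum>n\<in>J. \<Sum>p<d. \<Sum>q<d. (w p m * cnj (z p n)) * cnj (w q m * cnj (z q n)))"
    by (simp only: sum.swap[of _ I "{..<d}"] sum.swap[of _ J "{..<d}"])
  also have "\<dots> = of_real (\<Sum>m\<in>I. \<Sum>n\<in>J. (cmod (\<Sum>p<d. w p m * cnj (z p n)))\<^sup>2)"
    by (simp only: of_real_sum complex_norm_square cnj_sum sum_product)
  finally show ?thesis .
qed

lemma tensor_mat_factor: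
  assumes "\<And>i j. i < dA \<Longrightarrow> j < dA \<Longrightarrow> M $$ (i, j) = (\<Sum>k\<in>I. L i k * cnj (L j k))"
    and "\<And>i j. i < dB \<Longrightarrow> j < dB \<Longrightarrow> N $$ (i, j) = (\<Sum>l\<in>J. K i l * cnj (K j l))"
    and "M \<in> carrier_mat dA dA" "N \<in> carrier_mat dB dB"
    and "p < dA * dB" "q < dA * dB"
  shows "tensor_mat M N $$ (p, q) = (\<Sum>(k, l)\<in>I \<times> J.
    (L (p div dB) k * K (p mod dB) l) * cnj (L (q div dB) k * K (q mod dB) l))"
proof -
  have "dB > 0" using assms(5) by (cases dB) auto
  then have "p div dB < dA" "q div dB < dA" "p mod dB < dB" "q mod dB < dB"
    using assms(5,6) by (simp_all add: less_mult_imp_div_less)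
  then show ?thesis
    using assms by (simp add: tensor_mat_def sum_product sum.cartesian_product mult_ac)
qed

lemma trace_nonneg:
  assumes "positive_semidefinite (dA * dB) \<rho>" "positive_semidefinite dA M" "positive_semidefinite dB N"
  shows "0 \<le> Re (mtrace (\<rho> * tensor_mat M N))"
proof -
  obtain w where w: "\<And>p q. p < dA * dB \<Longrightarrow> q < dA * dB \<Longrightarrow> \<rho> $$ (p, q) = (\<Sum>m<dA * dB. w p m * cnj (w q m))"
    using positive_semidefinite_factor[OF assms(1)] by blast
  obtain L where L: "\<And>i j. i < dA \<Longrightarrow> j < dA \<Longrightarrow> M $$ (i, j) = (\<Sum>k<dA. L i k * cnj (L j k))"
    using positive_semidefinite_factor[OF assms(2)] by blast
  obtain K where K: "\<And>i j. i < dB \<Longrightarrow> j < dB \<Longrightarrow> N $$ (i, j) = (\<Sum>l<dB. K i l * cnj (K j l))"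
    using positive_semidefinite_factor[OF assms(3)] by blast
  have car: "\<rho> \<in> carrier_mat (dA * dB) (dA * dB)" "M \<in> carrier_mat dA dA" "N \<in> carrier_mat dB dB"
    using assms by (auto simp: positive_semidefinite_def)
  show ?thesis
    using trace_of_factors[of "dA * dB" \<rho> w "{..<dA * dB}" "tensor_mat M N"
        "\<lambda>p kl. L (p div dB) (fst kl) * K (p mod dB) (snd kl)" "{..<dA} \<times> {..<dB}"] w car
      tensor_mat_factor[OF L K car(2,3)]
    by (auto simp: tensor_mat_def case_prod_beta intro!: sum_nonneg)
qed

section \<open>Total probability and perfect strategies\<close>

lemma povm_sum:
  assumes "povm d n E" "i < d" "j < d"
  shows "(\<Sum>a<n. E a $$ (i, j)) = (if i = j then 1 else 0)"
proof -
  have "Matrix.mat d d (\<lambda>ij. \<Sum>a<n. E a $$ ij) $$ (i, j) = 1\<^sub>m d $$ (i, j)"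
    using assms(1) by (simp add: povm_def)
  then show ?thesis
    using assms(2,3) by simp
qed

lemma povm_carrier: "povm d n E \<Longrightarrow> a < n \<Longrightarrow> E a \<in> carrier_mat d d"
  by (simp add: povm_def positive_semidefinite_def)

lemma total_probability:
  assumes \<rho>: "\<rho> \<in> carrier_mat (dA * dB) (dA * dB)" and M: "povm dA m M" and N: "povm dB n N"
  shows "(\<Sum>a<m. \<Sum>b<n. mtrace (\<rho> * tensor_mat (M a) (N b))) = mtrace \<rho>"
proof -
  let ?d = "dA * dB"
  have entry: "mtrace (\<rho> * tensor_mat (M a) (N b)) =
      (\<Sum>p<?d. \<Sum>q<?d. \<rho> $$ (p, q) * (M a $$ (q div dB, p div dB) * N b $$ (q mod dB, p mod dB)))"
    if "a < m" "b < n" for a b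
    using \<rho> povm_carrier[OF M that(1)] povm_carrier[OF N that(2)]
    by (auto simp: mtrace_def tensor_mat_def scalar_prod_def atLeast0LessThan intro!: sum.cong)
  have "(\<Sum>a<m. \<Sum>b<n. mtrace (\<rho> * tensor_mat (M a) (N b))) =
      (\<Sum>a<m. \<Sum>b<n. \<Sum>p<?d. \<Sum>q<?d. \<rho> $$ (p, q) * (M a $$ (q div dB, p div dB) * N b $$ (q mod dB, p mod dB)))"
    by (intro sum.cong refl) (simp add: entry)
  also have "\<dots> = (\<Sum>p<?d. \<Sum>q<?d. \<Sum>a<m. \<Sum>b<n. \<rho> $$ (p, q) * (M a $$ (q div dB, p div dB) * N b $$ (q mod dB, p mod dB)))"
    by (simp only: sum.swap[of _ "{..<?d}" "{..<m}"] sum.swap[of _ "{..<?d}" "{..<n}"])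
  also have "\<dots> = (\<Sum>p<?d. \<Sum>q<?d. if q = p then \<rho> $$ (p, q) else 0)"
  proof (intro sum.cong refl)
    fix p q assume "p \<in> {..<?d}" "q \<in> {..<?d}"
    then have pq: "p < ?d" "q < ?d" by auto
    then have "dB > 0" by (cases dB) auto
    with pq have *: "p div dB < dA" "q div dB < dA" "p mod dB < dB" "q mod dB < dB"
      by (simp_all add: less_mult_imp_div_less)
    have "(\<Sum>a<m. \<Sum>b<n. \<rho> $$ (p, q) * (M a $$ (q div dB, p div dB) * N b $$ (q mod dB, p mod dB))) =
        \<rho> $$ (p, q) * ((\<Sum>a<m. M a $$ (q div dB, p div dB)) * (\<Sum>b<n. N b $$ (q mod dB, p mod dB)))"
      by (subst sum_product) (simp add: sum_distrib_left)
    moreover have "q = p \<longleftrightarrow> q div dB = p div dB \<and> q mod dB = p mod dB"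
      by (metis div_mult_mod_eq)
    then have "\<rho> $$ (p, q) * ((\<Sum>a<m. M a $$ (q div dB, p div dB)) * (\<Sum>b<n. N b $$ (q mod dB, p mod dB))) =
        (if q = p then \<rho> $$ (p, q) else 0)"
      using povm_sum[OF M *(2,1)] povm_sum[OF N *(4,3)] by simp
    ultimately show "(\<Sum>a<m. \<Sum>b<n. \<rho> $$ (p, q) * (M a $$ (q div dB, p div dB) * N b $$ (q mod dB, p mod dB))) =
        (if q = p then \<rho> $$ (p, q) else 0)"
      by simp
  qed
  also have "\<dots> = mtrace \<rho>"
    using \<rho> by (auto simp: mtrace_def intro!: sum.cong)
  finally show ?thesis .
qed

text \<open>The outcome probabilities of each question pair add up to 1, so the defect from a
  perfect score is a sum over losing outcomes only. As its terms are nonnegative, it gives both the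
  bound 1 and the characterization of perfect strategies.\<close>

lemma losing_probability:
  assumes "quantum_strategy dA dB \<rho> M N"
  shows "1 - winning_prob \<rho> M N =
    1 / 12 * (\<Sum>x<4. \<Sum>y<3. \<Sum>a<5. \<Sum>b<5. (1 - win_pred x y a b) * Re (mtrace (\<rho> * tensor_mat (M x a) (N y b))))"
proof -
  have total: "(\<Sum>a<5. \<Sum>b<5. Re (mtrace (\<rho> * tensor_mat (M x a) (N y b)))) = 1" if "x < 4" "y < 3" for x y
  proof -
    have "(\<Sum>a<5. \<Sum>b<5. mtrace (\<rho> * tensor_mat (M x a) (N y b))) = 1"
      using total_probability[of \<rho> dA dB 5 "M x" 5 "N y"] assms that
      by (auto simp: quantum_strategy_def density_operator_def positive_semidefinite_def)
    then show ?thesis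
      by (metis (mono_tags, lifting) Re_sum one_complex.sel(1) sum.cong)
  qed
  have "(\<Sum>x<4. \<Sum>y<3. \<Sum>a<5. \<Sum>b<5. Re (mtrace (\<rho> * tensor_mat (M x a) (N y b)))) = (\<Sum>x<4::nat. \<Sum>y<3::nat. 1)"
    by (intro sum.cong refl) (use total in auto)
  then show ?thesis
    by (simp add: winning_prob_def left_diff_distrib sum_subtractf)
qed

lemma losing_terms_nonneg:
  assumes "quantum_strategy dA dB \<rho> M N" "x < 4" "y < 3" "a < 5" "b < 5"
  shows "0 \<le> (1 - win_pred x y a b) * Re (mtrace (\<rho> * tensor_mat (M x a) (N y b)))"
  using assms
  by (auto simp: quantum_strategy_def density_operator_def povm_def win_pred_bounds
      intro!: mult_nonneg_nonneg trace_nonneg)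

lemma winning_prob_le_1:
  assumes "quantum_strategy dA dB \<rho> M N"
  shows "winning_prob \<rho> M N \<le> 1"
proof -
  have "0 \<le> 1 - winning_prob \<rho> M N"
    unfolding losing_probability[OF assms]
    by (intro mult_nonneg_nonneg sum_nonneg losing_terms_nonneg[OF assms]) auto
  then show ?thesis by simp
qed

lemma perfect_iff:
  assumes "quantum_strategy dA dB \<rho> M N"
  shows "winning_prob \<rho> M N = 1 \<longleftrightarrow>
    (\<forall>x<4. \<forall>y<3. \<forall>a<5. \<forall>b<5. win_pred x y a b = 0 \<longrightarrow> Re (mtrace (\<rho> * tensor_mat (M x a) (N y b))) = 0)"
proof -
  let ?g = "\<lambda>x y a b. (1 - win_pred x y a b) * Re (mtrace (\<rho> * tensor_mat (M x a) (N y b)))"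
  have "winning_prob \<rho> M N = 1 \<longleftrightarrow> (\<Sum>x<4. \<Sum>y<3. \<Sum>a<5. \<Sum>b<5. ?g x y a b) = 0"
    using losing_probability[OF assms] by auto
  also have "\<dots> \<longleftrightarrow> (\<Sum>(x, y, a, b)\<in>{..<4} \<times> {..<3} \<times> {..<5} \<times> {..<5}. ?g x y a b) = 0"
    by (simp only: sum.cartesian_product)
  also have "\<dots> \<longleftrightarrow> (\<forall>z\<in>{..<4} \<times> {..<3} \<times> {..<5} \<times> {..<5}. (case z of (x, y, a, b) \<Rightarrow> ?g x y a b) = 0)"
    by (rule sum_nonneg_eq_0_iff) (auto intro: losing_terms_nonneg[OF assms])
  also have "\<dots> \<longleftrightarrow> (\<forall>x<4. \<forall>y<3. \<forall>a<5. \<forall>b<5. ?g x y a b = 0)"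
    by (simp add: Ball_def del: mult_eq_0_iff) blast
  also have "\<dots> \<longleftrightarrow> (\<forall>x<4. \<forall>y<3. \<forall>a<5. \<forall>b<5. win_pred x y a b = 0 \<longrightarrow> Re (mtrace (\<rho> * tensor_mat (M x a) (N y b))) = 0)"
    by (auto simp: win_pred_def)
  finally show ?thesis .
qed

section \<open>The quantum value\<close>

definition complex_vec :: "real Matrix.vec \<Rightarrow> complex Matrix.vec" where
  "complex_vec v = map_vec complex_of_real v"

definition weighted_state :: "complex Matrix.vec" where
  "weighted_state = Matrix.vec (5 * 5)
    (\<lambda>p. if p div 5 = p mod 5 then of_real ((if p mod 5 < 4 then 2 else 1) / sqrt 17) else 0)"

lemma dim_u_vec [simp]: "x < 4 \<Longrightarrow> a < 5 \<Longrightarrow> dim_vec (u_vec x a) = 5"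
  by (simp add: u_vec_def unit_length_def u_rows_eq)

lemma dim_v_vec [simp]: "y < 3 \<Longrightarrow> b < 5 \<Longrightarrow> dim_vec (v_vec y b) = 5"
  by (simp add: v_vec_def unit_length_def v_rows_eq)

text \<open>The square roots of the normalization occur in pairs, so the completeness of the bases
  reduces to rational arithmetic.\<close>

lemma unit_length_entries:
  assumes "v \<in> carrier_vec n" "i < n" "j < n"
  shows "vec_index (unit_length v) i * vec_index (unit_length v) j =
    vec_index v i * vec_index v j / scalar_prod v v"
proof -
  have "scalar_prod v v \<ge> 0"
    by (auto simp: scalar_prod_def intro!: sum_nonneg)
  then show ?thesis
    using assms by (simp add: unit_length_def)
qed

lemma u_complete:
  assumes "x < 4" "i < 5" "j < 5"
  shows "(\<Sum>a<5. vec_index (u_vec x a) i * vec_index (u_vec x a) j) = (if i = j then 1 else 0)"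
proof -
  have u: "u_rows ! x ! a \<in> carrier_vec 5" if "a < 5" for a
    using u_rows_eq[OF assms(1) that] by simp
  have "(\<Sum>a<5. vec_index (u_vec x a) i * vec_index (u_vec x a) j) =
      (\<Sum>a<5. of_int (u_int ! x ! a ! i * u_int ! x ! a ! j) / of_int (\<Sum>k<5. u_int ! x ! a ! k * u_int ! x ! a ! k))"
    using assms u
    by (intro sum.cong refl)
      (simp add: u_vec_def unit_length_entries[of _ 5], simp add: u_rows_eq scalar_prod_def atLeast0LessThan)
  also have "\<dots> = (if i = j then 1 else 0)"
    using less_4_cases[OF assms(1)] less_5_cases[OF assms(2)] less_5_cases[OF assms(3)]
    unfolding sum_less_5
    by (elim disjE) (simp_all add: u_int_def)
  finally show ?thesis .
qed

lemma v_complete: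
  assumes "y < 3" "i < 5" "j < 5"
  shows "(\<Sum>b<5. vec_index (v_vec y b) i * vec_index (v_vec y b) j) = (if i = j then 1 else 0)"
proof -
  have v: "v_rows ! y ! b \<in> carrier_vec 5" if "b < 5" for b
    using v_rows_eq[OF assms(1) that] by simp
  have "(\<Sum>b<5. vec_index (v_vec y b) i * vec_index (v_vec y b) j) =
      (\<Sum>b<5. of_int (v_int ! y ! b ! i * v_int ! y ! b ! j) / of_int (\<Sum>k<5. v_int ! y ! b ! k * v_int ! y ! b ! k))"
    using assms v
    by (intro sum.cong refl)
      (simp add: v_vec_def unit_length_entries[of _ 5],
       simp add: v_rows_eq scalar_prod_def atLeast0LessThan flip: sum_divide_distrib)
  also have "\<dots> = (if i = j then 1 else 0)"
    using less_3_cases[OF assms(1)] less_5_cases[OF assms(2)] less_5_cases[OF assms(3)]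
    unfolding sum_less_5
    by (elim disjE) (simp_all add: v_int_def)
  finally show ?thesis .
qed

lemma povm_complex_ketbra:
  assumes "\<And>a. a < 5 \<Longrightarrow> dim_vec (w a) = 5"
    and "\<And>i j. i < 5 \<Longrightarrow> j < 5 \<Longrightarrow> (\<Sum>a<5. vec_index (w a) i * vec_index (w a) j) = (if i = j then 1 else 0)"
  shows "povm 5 5 (\<lambda>a. ketbra (complex_vec (w a)))"
  unfolding povm_def
proof (intro conjI allI impI)
  fix a :: nat assume "a < 5"
  then show "positive_semidefinite 5 (ketbra (complex_vec (w a)))"
    using assms(1) by (intro positive_semidefinite_ketbra carrier_vecI) (simp add: complex_vec_def)
next
  show "Matrix.mat 5 5 (\<lambda>ij. \<Sum>a<5. ketbra (complex_vec (w a)) $$ ij) = 1\<^sub>m 5"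
  proof (rule eq_matI)
    fix i j :: nat assume "i < dim_row (1\<^sub>m 5 :: complex Matrix.mat)" "j < dim_col (1\<^sub>m 5 :: complex Matrix.mat)"
    then have ij: "i < 5" "j < 5" by auto
    have "(\<Sum>a<5. ketbra (complex_vec (w a)) $$ (i, j)) = of_real (\<Sum>a<5. vec_index (w a) i * vec_index (w a) j)"
      unfolding of_real_sum using assms(1) ij by (intro sum.cong) (auto simp: ketbra_def complex_vec_def)
    then show "Matrix.mat 5 5 (\<lambda>ij. \<Sum>a<5. ketbra (complex_vec (w a)) $$ ij) $$ (i, j) = 1\<^sub>m 5 $$ (i, j)"
      using ij assms(2) by simp
  qed auto
qed

lemma sum_diagonal:
  fixes f :: "nat \<Rightarrow> nat \<Rightarrow> 'b::comm_monoid_add"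
  shows "(\<Sum>p<5 * 5::nat. if p div 5 = p mod 5 then f (p div 5) (p mod 5) else 0) = (\<Sum>i<5. f i i)"
  unfolding sum_div_mod[of "\<lambda>i j. if i = j then f i j else 0"] by simp

lemma weighted_state_norm: "mtrace (ketbra weighted_state) = 1"
proof -
  have "mtrace (ketbra weighted_state) =
      (\<Sum>p<5 * 5::nat. if p div 5 = p mod 5 then of_real ((if p mod 5 < 4 then 4 else 1) / 17) else 0)"
    unfolding mtrace_def ketbra_def weighted_state_def
    by (intro sum.cong) (auto simp flip: of_real_mult)
  also have "\<dots> = (\<Sum>i<5::nat. of_real ((if i < 4 then 4 else 1) / 17))"
    by (rule sum_diagonal)
  also have "\<dots> = 1"
    by (simp add: sum_less_5)
  finally show ?thesis .
qed

lemma trace_ketbra: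
  assumes "\<phi> \<in> carrier_vec (m * n)" "a \<in> carrier_vec m" "b \<in> carrier_vec n"
  shows "mtrace (ketbra \<phi> * tensor_mat (ketbra a) (ketbra b)) =
    of_real ((cmod (\<Sum>p<m * n. vec_index \<phi> p * cnj (vec_index a (p div n) * vec_index b (p mod n))))\<^sup>2)"
proof -
  have a: "ketbra a \<in> carrier_mat m m" "ketbra b \<in> carrier_mat n n" "ketbra \<phi> \<in> carrier_mat (m * n) (m * n)"
    using assms by (auto simp: ketbra_def)
  have T: "tensor_mat (ketbra a) (ketbra b) \<in> carrier_mat (m * n) (m * n)"
    using a by (auto simp: tensor_mat_def)
  have "tensor_mat (ketbra a) (ketbra b) $$ (p, q) =
     (\<Sum>k\<in>{()}. (vec_index a (p div n) * vec_index b (p mod n)) * cnj (vec_index a (q div n) * vec_index b (q mod n)))"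
    if "p < m * n" "q < m * n" for p q
    using tensor_mat_factor[of m "ketbra a" "\<lambda>i k. vec_index a i" "{()}" n "ketbra b" "\<lambda>i k. vec_index b i" "{()}"] assms a that
    by (simp add: ketbra_def)
  then show ?thesis
    using trace_of_factors[of "m * n" "ketbra \<phi>" "\<lambda>p _. vec_index \<phi> p" "{()}" "tensor_mat (ketbra a) (ketbra b)"
       "\<lambda>p _. vec_index a (p div n) * vec_index b (p mod n)" "{()}"] assms a T
    by (simp add: ketbra_def)
qed

lemma weighted_state_amplitude:
  assumes "x < 4" "y < 3" "a < 5" "b < 5"
  shows "(\<Sum>p<5 * 5. vec_index weighted_state p *
      cnj (vec_index (complex_vec (u_vec x a)) (p div 5) * vec_index (complex_vec (v_vec y b)) (p mod 5))) =
    of_real (scalar_prod (u_vec x a) (D5 *\<^sub>v v_vec y b) / sqrt 17)" (is "?lhs = _")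
proof -
  have "?lhs = (\<Sum>p<5 * 5. if p div 5 = p mod 5 then
      of_real ((if p mod 5 < 4 then 2 else 1) / sqrt 17 * (vec_index (u_vec x a) (p div 5) * vec_index (v_vec y b) (p mod 5))) else 0)"
    using assms by (intro sum.cong) (auto simp: weighted_state_def complex_vec_def less_mult_imp_div_less)
  also have "\<dots> = (\<Sum>i<5. of_real ((if i < 4 then 2 else 1) / sqrt 17 * (vec_index (u_vec x a) i * vec_index (v_vec y b) i)))"
    by (rule sum_diagonal)
  also have "\<dots> = of_real (scalar_prod (u_vec x a) (D5 *\<^sub>v v_vec y b) / sqrt 17)"
    using assms
    by (simp add: D5_def mat_diag_def scalar_prod_def atLeast0LessThan sum_less_5 add_divide_distrib mult_ac)
  finally show ?thesis .
qed

lemma perfect_strategy: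
  obtains M N where "quantum_strategy 5 5 (ketbra weighted_state) M N"
    "winning_prob (ketbra weighted_state) M N = 1"
proof
  let ?M = "\<lambda>x a. ketbra (complex_vec (u_vec x a))" and ?N = "\<lambda>y b. ketbra (complex_vec (v_vec y b))"
  have car: "weighted_state \<in> carrier_vec (5 * 5)"
    by (simp add: weighted_state_def)
  show strategy: "quantum_strategy 5 5 (ketbra weighted_state) ?M ?N"
    unfolding quantum_strategy_def density_operator_def
    using car weighted_state_norm
    by (auto intro!: positive_semidefinite_ketbra povm_complex_ketbra u_complete v_complete)
  have "mtrace (ketbra weighted_state * tensor_mat (?M x a) (?N y b)) = 0"
    if "x < 4" "y < 3" "a < 5" "b < 5" "win_pred x y a b = 0" for x y a b
  proof -
    have "scalar_prod (u_vec x a) (D5 *\<^sub>v v_vec y b) = 0"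
      using that(5) by (simp add: win_pred_def split: if_splits)
    moreover have "complex_vec (u_vec x a) \<in> carrier_vec 5" "complex_vec (v_vec y b) \<in> carrier_vec 5"
      using that by (auto simp: complex_vec_def intro!: carrier_vecI)
    ultimately show ?thesis
      by (simp only: trace_ketbra[OF car] weighted_state_amplitude[OF that(1-4)]) simp
  qed
  then show "winning_prob (ketbra weighted_state) ?M ?N = 1"
    unfolding perfect_iff[OF strategy] by (auto simp only: zero_complex.sel)
qed

lemma quantum_value: "quantum_value = 1"
  unfolding quantum_value_def
proof (rule cSup_eq_maximum)
  obtain M N where "quantum_strategy 5 5 (ketbra weighted_state) M N" "winning_prob (ketbra weighted_state) M N = 1"
    by (rule perfect_strategy)
  then show "1 \<in> {winning_prob \<rho> M N |dA dB \<rho> M N. quantum_strategy dA dB \<rho> M N}"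
    by (intro CollectI exI conjI) (rule sym)
qed (use winning_prob_le_1 in blast)

section \<open>Maximally entangled states\<close>

text \<open>
  The matrices below have a size that is only known inside the proof; block diagonal repetition
  embeds all of them, with their units, into the single ring of additive maps on sequences.
\<close>

typedef endo = "{F :: (nat \<Rightarrow> complex) \<Rightarrow> (nat \<Rightarrow> complex). \<forall>x y. F (\<lambda>i. x i + y i) = (\<lambda>i. F x i + F y i)}"
  by (rule exI[of _ "\<lambda>x. x"]) simp

setup_lifting type_definition_endo

instantiation endo :: ring_1
begin

lift_definition zero_endo :: endo is "\<lambda>x i. 0" by simp
lift_definition one_endo :: endo is "\<lambda>x. x" by simp
lift_definition plus_endo :: "endo \<Rightarrow> endo \<Rightarrow> endo" is "\<lambda>F G x i. F x i + G x i"
  by (simp add: add_ac)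
lift_definition uminus_endo :: "endo \<Rightarrow> endo" is "\<lambda>F x i. - F x i"
  by simp
lift_definition minus_endo :: "endo \<Rightarrow> endo \<Rightarrow> endo" is "\<lambda>F G x i. F x i - G x i"
  by (simp add: algebra_simps)
lift_definition times_endo :: "endo \<Rightarrow> endo \<Rightarrow> endo" is "\<lambda>F G x. F (G x)"
  by simp

instance
proof
  show "(0::endo) \<noteq> 1"
    by transfer (auto simp: fun_eq_iff intro: exI[of _ "\<lambda>_. 1"])
qed (transfer; simp add: fun_eq_iff algebra_simps)+

end

lemma endo_torsion2: "z + z = (0::endo) \<Longrightarrow> z = 0"
  by transfer (simp add: fun_eq_iff)

lemma endo_torsion3: "z + z + z = (0::endo) \<Longrightarrow> z = 0"
proof transfer
  fix F :: "(nat \<Rightarrow> complex) \<Rightarrow> (nat \<Rightarrow> complex)"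
  assume "(\<lambda>x i. F x i + F x i + F x i) = (\<lambda>x i. 0)"
  then have "3 * F x i = 0" for x i
    by (simp add: fun_eq_iff)
  then show "F = (\<lambda>x i. 0)"
    by (simp add: fun_eq_iff)
qed

text \<open>\<open>i - i mod r\<close> is the first index of the block of length \<open>r\<close>
  containing \<open>i\<close>, and \<open>i mod r\<close> is the position within that block.\<close>

lift_definition block_op :: "nat \<Rightarrow> (nat \<Rightarrow> nat \<Rightarrow> complex) \<Rightarrow> endo" is
  "\<lambda>r M x i. \<Sum>j<r. M (i mod r) j * x (i - i mod r + j)"
  by (simp add: distrib_left sum.distrib)

lemma block_op_cong:
  assumes "r > 0" "\<And>i j. i < r \<Longrightarrow> j < r \<Longrightarrow> M i j = N i j"
  shows "block_op r M = block_op r N"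
  using assms by transfer (auto simp: fun_eq_iff intro!: sum.cong)

lemma block_op_zero: "block_op r (\<lambda>i j. 0) = 0"
  by transfer simp

lemma block_op_one:
  assumes "r > 0"
  shows "block_op r (\<lambda>i j. if i = j then 1 else 0) = 1"
  using assms
proof transfer
  fix r :: nat assume "r > 0"
  then have "(\<Sum>j<r. (if i mod r = j then 1 else 0) * x (i - i mod r + j)) = x i" for x :: "nat \<Rightarrow> complex" and i
    by (subst sum.cong[OF refl, where h = "\<lambda>j. if j = i mod r then x i else 0"]) auto
  then show "(\<lambda>x i. \<Sum>j<r. (if i mod r = j then 1 else 0) * x (i - i mod r + j)) = (\<lambda>x. x :: nat \<Rightarrow> complex)"
    by blast
qed

lemma block_op_add: "block_op r M + block_op r N = block_op r (\<lambda>i j. M i j + N i j)"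
  by transfer (simp add: distrib_right sum.distrib)

lemma block_op_sum: "(\<Sum>a<n. block_op r (M a)) = block_op r (\<lambda>i j. \<Sum>a<(n::nat). M a i j)"
  by (induction n) (simp_all add: block_op_zero block_op_add)

lemma block_op_mult:
  assumes "r > 0"
  shows "block_op r M * block_op r N = block_op r (\<lambda>i k. \<Sum>j<r. M i j * N j k)"
  using assms
proof transfer
  fix r :: nat and M N :: "nat \<Rightarrow> nat \<Rightarrow> complex" assume r: "r > 0"
  have mod: "(i - i mod r + j) mod r = j" if "j < r" for i j
    using that by (simp add: minus_mod_eq_mult_div)
  have "(\<Sum>j<r. M (i mod r) j * (\<Sum>k<r. N ((i - i mod r + j) mod r) k * x (i - i mod r + j - (i - i mod r + j) mod r + k))) =
      (\<Sum>k<r. (\<Sum>j<r. M (i mod r) j * N j k) * x (i - i mod r + k))" for x i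
  proof -
    have "(\<Sum>j<r. M (i mod r) j * (\<Sum>k<r. N ((i - i mod r + j) mod r) k * x (i - i mod r + j - (i - i mod r + j) mod r + k))) =
        (\<Sum>j<r. \<Sum>k<r. M (i mod r) j * N j k * x (i - i mod r + k))"
      by (intro sum.cong refl) (simp only: lessThan_iff mod diff_add_inverse2 sum_distrib_left mult.assoc)
    also have "\<dots> = (\<Sum>k<r. (\<Sum>j<r. M (i mod r) j * N j k) * x (i - i mod r + k))"
      by (subst sum.swap) (simp add: sum_distrib_right)
    finally show ?thesis .
  qed
  then show "(\<lambda>x i. \<Sum>j<r. M (i mod r) j * (\<Sum>k<r. N ((i - i mod r + j) mod r) k *
      x (i - i mod r + j - (i - i mod r + j) mod r + k))) =
      (\<lambda>x i. \<Sum>k<r. (\<Sum>j<r. M (i mod r) j * N j k) * x (i - i mod r + k))"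
    by blast
qed

text \<open>Zero coefficients are dropped and the remaining indices \<open>I\<close> renumbered; the
  others share one value \<open>c\<close>, and the norm of \<phi> shows that some index
  remains.\<close>

lemma maximally_entangled_flat:
  assumes "maximally_entangled dA dB \<phi>"
  obtains r c a b where "r > 0" "c \<noteq> 0" "orthonormal_family dA r a" "orthonormal_family dB r b"
    "\<phi> \<in> carrier_vec (dA * dB)"
    "\<And>p. p < dA * dB \<Longrightarrow> vec_index \<phi> p = c * (\<Sum>m<r. vec_index (a m) (p div dB) * vec_index (b m) (p mod dB))"
proof -
  obtain r s a b where \<phi>: "\<phi> \<in> carrier_vec (dA * dB)" "\<phi> \<bullet>c \<phi> = 1"
    and a: "orthonormal_family dA r a" and b: "orthonormal_family dB r b"
    and \<phi>_eq: "\<phi> = Matrix.vec (dA * dB) (\<lambda>j. \<Sum>i<r. complex_of_real (s i) * vec_index (tensor_vec (a i) (b i)) j)"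
    and flat: "\<And>i j. i < r \<Longrightarrow> j < r \<Longrightarrow> s i \<noteq> 0 \<Longrightarrow> s j \<noteq> 0 \<Longrightarrow> s i = s j"
    using assms unfolding maximally_entangled_def schmidt_decomposition_def by auto
  define I where "I = {i. i < r \<and> s i \<noteq> 0}"
  have "finite I" by (simp add: I_def)
  then obtain h where h: "bij_betw h {..<card I} I"
    using ex_bij_betw_nat_finite by (metis atLeast0LessThan)
  have tensor: "vec_index (tensor_vec (a i) (b i)) p = vec_index (a i) (p div dB) * vec_index (b i) (p mod dB)"
    if "i < r" "p < dA * dB" for i p
  proof -
    have "a i \<in> carrier_vec dA" "b i \<in> carrier_vec dB"
      using a b that by (auto simp: orthonormal_family_def)
    then show ?thesis
      using that by (simp add: tensor_vec_def)
  qed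
  have \<phi>_I: "vec_index \<phi> p = (\<Sum>i\<in>I. complex_of_real (s i) * (vec_index (a i) (p div dB) * vec_index (b i) (p mod dB)))"
    if "p < dA * dB" for p
  proof -
    have "vec_index \<phi> p = (\<Sum>i<r. complex_of_real (s i) * (vec_index (a i) (p div dB) * vec_index (b i) (p mod dB)))"
      unfolding \<phi>_eq using that tensor by simp
    also have "\<dots> = (\<Sum>i\<in>I. complex_of_real (s i) * (vec_index (a i) (p div dB) * vec_index (b i) (p mod dB)))"
      by (rule sum.mono_neutral_right) (auto simp: I_def)
    finally show ?thesis .
  qed
  have "I \<noteq> {}"
  proof
    assume "I = {}"
    then have "\<phi> \<bullet>c \<phi> = 0"
      using \<phi>(1) \<phi>_I by (auto simp: scalar_prod_def intro!: sum.neutral)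
    then show False using \<phi>(2) by simp
  qed
  then obtain i0 where i0: "i0 \<in> I" by blast
  have h_I: "h m < r" "s (h m) = s i0" if "m < card I" for m
    using bij_betwE[OF h] that i0 flat[of "h m" i0] by (auto simp: I_def)
  have h_inj: "h m = h n \<longleftrightarrow> m = n" if "m < card I" "n < card I" for m n
    using h that by (auto simp: bij_betw_def inj_on_def)
  show thesis
  proof (rule that[of "card I" "complex_of_real (s i0)" "a \<circ> h" "b \<circ> h"])
    show "card I > 0"
      using \<open>I \<noteq> {}\<close> \<open>finite I\<close> by (simp add: card_gt_0_iff)
    show "complex_of_real (s i0) \<noteq> 0"
      using i0 by (simp add: I_def)
    show "orthonormal_family dA (card I) (a \<circ> h)" "orthonormal_family dB (card I) (b \<circ> h)"
      using a b h_I h_inj by (auto simp: orthonormal_family_def)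
    show "\<phi> \<in> carrier_vec (dA * dB)" by fact
    fix p assume p: "p < dA * dB"
    show "vec_index \<phi> p = complex_of_real (s i0) *
        (\<Sum>m<card I. vec_index ((a \<circ> h) m) (p div dB) * vec_index ((b \<circ> h) m) (p mod dB))"
      unfolding \<phi>_I[OF p] sum.reindex_bij_betw[OF h, symmetric] sum_distrib_left
      by (intro sum.cong) (simp_all add: h_I)
  qed
qed

section \<open>Compression of effects to the Schmidt bases\<close>

definition compress :: "nat \<Rightarrow> (nat \<Rightarrow> complex Matrix.vec) \<Rightarrow> complex Matrix.mat \<Rightarrow> nat \<Rightarrow> nat \<Rightarrow> complex" where
  "compress d a M m n = (\<Sum>i<d. \<Sum>j<d. cnj (vec_index (a m) i) * M $$ (i, j) * vec_index (a n) j)"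

text \<open>A compressed effect is again a Gram matrix, built from the overlaps of the vectors
  \<open>a m\<close> with the columns of \<open>L\<close>.\<close>

lemma compress_factor:
  assumes "\<And>i j. i < d \<Longrightarrow> j < d \<Longrightarrow> M $$ (i, j) = (\<Sum>k<d. L i k * cnj (L j k))"
  shows "compress d a M m n =
    (\<Sum>k<d. cnj (\<Sum>i<d. vec_index (a m) i * cnj (L i k)) * (\<Sum>i<d. vec_index (a n) i * cnj (L i k)))"
proof -
  have "compress d a M m n =
      (\<Sum>i<d. \<Sum>j<d. \<Sum>k<d. (cnj (vec_index (a m) i) * L i k) * (vec_index (a n) j * cnj (L j k)))"
    unfolding compress_def
    by (intro sum.cong refl) (simp add: assms sum_distrib_left sum_distrib_right mult_ac)
  also have "\<dots> = (\<Sum>k<d. \<Sum>i<d. \<Sum>j<d. (cnj (vec_index (a m) i) * L i k) * (vec_index (a n) j * cnj (L j k)))"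
    by (subst sum.swap[of _ "{..<d}" "{..<d}"], rule sum.cong[OF refl], subst sum.swap) simp
  also have "\<dots> = (\<Sum>k<d. cnj (\<Sum>i<d. vec_index (a m) i * cnj (L i k)) * (\<Sum>i<d. vec_index (a n) i * cnj (L i k)))"
    by (simp add: sum_product)
  finally show ?thesis .
qed

lemma compress_povm:
  assumes "povm d l E" "orthonormal_family d r a" "m < r" "n < r"
  shows "(\<Sum>e<l. compress d a (E e) m n) = (if m = n then 1 else 0)"
proof -
  have carrier: "a m \<in> carrier_vec d" "a n \<in> carrier_vec d"
    using assms by (auto simp: orthonormal_family_def)
  have "(\<Sum>e<l. compress d a (E e) m n) =
      (\<Sum>i<d. \<Sum>j<d. cnj (vec_index (a m) i) * (\<Sum>e<l. E e $$ (i, j)) * vec_index (a n) j)"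
    unfolding compress_def
    by (simp add: sum_distrib_left sum_distrib_right sum.swap[of _ "{..<d}" "{..<l}"])
  also have "\<dots> = (\<Sum>i<d. \<Sum>j<d. if j = i then cnj (vec_index (a m) i) * vec_index (a n) i else 0)"
    by (intro sum.cong refl) (auto simp: povm_sum[OF assms(1)])
  also have "\<dots> = a n \<bullet>c a m"
    using carrier by (simp add: scalar_prod_def atLeast0LessThan mult.commute)
  also have "\<dots> = (if m = n then 1 else 0)"
    using assms(2-4) unfolding orthonormal_family_def by simp
  finally show ?thesis .
qed

text \<open>A vanishing trace makes every amplitude between \<phi> and the columns of the factors
  vanish. Up to the nonzero constant \<open>c\<close> these amplitudes are the sums of
  \<open>\<alpha> n k * \<beta> n l\<close> over \<open>n\<close>, and both products of compressions
  are combinations of these sums or of their conjugates.\<close>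

lemma compress_orthogonal:
  assumes M: "positive_semidefinite dA M" and N: "positive_semidefinite dB N"
    and a: "orthonormal_family dA r a" and b: "orthonormal_family dB r b"
    and \<phi>: "\<phi> \<in> carrier_vec (dA * dB)" "c \<noteq> 0"
    and \<phi>_eq: "\<And>p. p < dA * dB \<Longrightarrow> vec_index \<phi> p = c * (\<Sum>m<r. vec_index (a m) (p div dB) * vec_index (b m) (p mod dB))"
    and zero: "Re (mtrace (ketbra \<phi> * tensor_mat M N)) = 0"
  shows "(\<Sum>n<r. compress dA a M m n * compress dB b N q n) = 0"
    and "(\<Sum>n<r. compress dB b N n m * compress dA a M n q) = 0"
proof -
  obtain L where L: "\<And>i j. i < dA \<Longrightarrow> j < dA \<Longrightarrow> M $$ (i, j) = (\<Sum>k<dA. L i k * cnj (L j k))"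
    using positive_semidefinite_factor[OF M] by blast
  obtain K where K: "\<And>i j. i < dB \<Longrightarrow> j < dB \<Longrightarrow> N $$ (i, j) = (\<Sum>l<dB. K i l * cnj (K j l))"
    using positive_semidefinite_factor[OF N] by blast
  have car: "M \<in> carrier_mat dA dA" "N \<in> carrier_mat dB dB"
    using M N by (auto simp: positive_semidefinite_def)
  define \<alpha> where "\<alpha> m k = (\<Sum>i<dA. vec_index (a m) i * cnj (L i k))" for m k
  define \<beta> where "\<beta> m l = (\<Sum>j<dB. vec_index (b m) j * cnj (K j l))" for m l
  have compress_M: "compress dA a M m n = (\<Sum>k<dA. cnj (\<alpha> m k) * \<alpha> n k)" for m n
    unfolding \<alpha>_def using compress_factor[OF L] .
  have compress_N: "compress dB b N m n = (\<Sum>l<dB. cnj (\<beta> m l) * \<beta> n l)" for m n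
    unfolding \<beta>_def using compress_factor[OF K] .
  let ?amp = "\<lambda>k l. \<Sum>p<dA * dB. vec_index \<phi> p * cnj (L (p div dB) k * K (p mod dB) l)"
  have "mtrace (ketbra \<phi> * tensor_mat M N) = of_real (\<Sum>m\<in>{()}. \<Sum>kl\<in>{..<dA} \<times> {..<dB}. (cmod (?amp (fst kl) (snd kl)))\<^sup>2)"
  proof (rule trace_of_factors)
    show "ketbra \<phi> $$ (p, q) = (\<Sum>m\<in>{()}. vec_index \<phi> p * cnj (vec_index \<phi> q))" if "p < dA * dB" "q < dA * dB" for p q
      using \<phi>(1) that by (simp add: ketbra_def)
    show "tensor_mat M N $$ (p, q) = (\<Sum>kl\<in>{..<dA} \<times> {..<dB}. (L (p div dB) (fst kl) * K (p mod dB) (snd kl)) *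
        cnj (L (q div dB) (fst kl) * K (q mod dB) (snd kl)))" if "p < dA * dB" "q < dA * dB" for p q
      using tensor_mat_factor[OF L K car that] by (simp add: case_prod_beta)
  qed (use \<phi>(1) car in \<open>auto simp: ketbra_def tensor_mat_def\<close>)
  then have "(\<Sum>kl\<in>{..<dA} \<times> {..<dB}. (cmod (?amp (fst kl) (snd kl)))\<^sup>2) = 0"
    using zero by simp
  then have amp: "?amp k l = 0" if "k < dA" "l < dB" for k l
    using that by (subst (asm) sum_nonneg_eq_0_iff) auto
  have \<alpha>\<beta>: "(\<Sum>n<r. \<alpha> n k * \<beta> n l) = 0" if "k < dA" "l < dB" for k l
  proof -
    have product: "(\<Sum>p<dA * dB. c * ((vec_index (a m) (p div dB) * cnj (L (p div dB) k)) *
        (vec_index (b m) (p mod dB) * cnj (K (p mod dB) l)))) = c * (\<alpha> m k * \<beta> m l)" for m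
      unfolding sum_div_mod[of "\<lambda>i j. c * ((vec_index (a m) i * cnj (L i k)) * (vec_index (b m) j * cnj (K j l)))"]
        \<alpha>_def \<beta>_def
      by (subst sum_product) (simp add: sum_distrib_left)
    have "?amp k l = (\<Sum>p<dA * dB. \<Sum>m<r. c * ((vec_index (a m) (p div dB) * cnj (L (p div dB) k)) *
        (vec_index (b m) (p mod dB) * cnj (K (p mod dB) l))))"
      by (intro sum.cong refl) (simp add: \<phi>_eq sum_distrib_left sum_distrib_right mult_ac)
    also have "\<dots> = (\<Sum>m<r. \<Sum>p<dA * dB. c * ((vec_index (a m) (p div dB) * cnj (L (p div dB) k)) *
        (vec_index (b m) (p mod dB) * cnj (K (p mod dB) l))))"
      by (rule sum.swap)
    also have "\<dots> = (\<Sum>m<r. c * (\<alpha> m k * \<beta> m l))"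
      unfolding product ..
    finally show ?thesis
      using amp[OF that] \<phi>(2) by (simp flip: sum_distrib_left)
  qed
  have "(\<Sum>n<r. compress dA a M m n * compress dB b N q n) =
      (\<Sum>n<r. \<Sum>k<dA. \<Sum>l<dB. cnj (\<alpha> m k) * cnj (\<beta> q l) * (\<alpha> n k * \<beta> n l))"
    unfolding compress_M compress_N sum_product by (simp add: mult_ac)
  also have "\<dots> = (\<Sum>k<dA. \<Sum>l<dB. \<Sum>n<r. cnj (\<alpha> m k) * cnj (\<beta> q l) * (\<alpha> n k * \<beta> n l))"
    by (simp only: sum.swap[of _ _ "{..<r}"])
  also have "\<dots> = 0"
    by (simp add: \<alpha>\<beta> flip: sum_distrib_left)
  finally show "(\<Sum>n<r. compress dA a M m n * compress dB b N q n) = 0" .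
  have "(\<Sum>n<r. compress dB b N n m * compress dA a M n q) =
      (\<Sum>n<r. \<Sum>l<dB. \<Sum>k<dA. \<beta> m l * \<alpha> q k * cnj (\<alpha> n k * \<beta> n l))"
    unfolding compress_M compress_N sum_product by (simp add: mult_ac)
  also have "\<dots> = (\<Sum>l<dB. \<Sum>k<dA. \<Sum>n<r. \<beta> m l * \<alpha> q k * cnj (\<alpha> n k * \<beta> n l))"
    by (simp only: sum.swap[of _ _ "{..<r}"])
  also have "\<dots> = 0"
    by (simp add: \<alpha>\<beta> flip: sum_distrib_left cnj_sum del: complex_cnj_mult)
  finally show "(\<Sum>n<r. compress dB b N n m * compress dA a M n q) = 0" .
qed

lemma no_perfect_maximally_entangled:
  assumes strategy: "quantum_strategy dA dB (ketbra \<phi>) M N" and ent: "maximally_entangled dA dB \<phi>"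
  shows "winning_prob (ketbra \<phi>) M N \<noteq> 1"
proof
  assume "winning_prob (ketbra \<phi>) M N = 1"
  then have zero: "Re (mtrace (ketbra \<phi> * tensor_mat (M x a) (N y b))) = 0"
    if "x < 4" "y < 3" "a < 5" "b < 5" "win_pred x y a b = 0" for x y a b
    using perfect_iff[OF strategy] that by blast
  obtain r c a b where r: "r > 0" and c: "c \<noteq> 0" and a: "orthonormal_family dA r a" and b: "orthonormal_family dB r b"
    and \<phi>: "\<phi> \<in> carrier_vec (dA * dB)"
      "\<And>p. p < dA * dB \<Longrightarrow> vec_index \<phi> p = c * (\<Sum>m<r. vec_index (a m) (p div dB) * vec_index (b m) (p mod dB))"
    by (rule maximally_entangled_flat[OF ent]) (rule that)
  have M: "povm dA 5 (M x)" if "x < 4" for x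
    using strategy that by (simp add: quantum_strategy_def)
  have N: "povm dB 5 (N y)" if "y < 3" for y
    using strategy that by (simp add: quantum_strategy_def)
  \<comment> \<open>Transposing Bob's compressions turns the contraction over the shared Schmidt
    index into a product of operators on one space.\<close>
  interpret game_operators "\<lambda>x i. block_op r (compress dA a (M x i))"
    "\<lambda>y j. block_op r (\<lambda>m n. compress dB b (N y j) n m)"
  proof
    show "(\<Sum>i<5. block_op r (compress dA a (M x i))) = 1" if "x < 4" for x
      unfolding block_op_sum block_op_one[OF r, symmetric]
      by (rule block_op_cong[OF r]) (simp add: compress_povm[OF M[OF that] a])
    show "(\<Sum>j<5. block_op r (\<lambda>m n. compress dB b (N y j) n m)) = 1" if "y < 3" for y
      unfolding block_op_sum block_op_one[OF r, symmetric]
      by (rule block_op_cong[OF r]) (auto simp: compress_povm[OF N[OF that] b])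
    fix x y i j :: nat assume *: "x < 4" "y < 3" "i < 5" "j < 5" "win_pred x y i j = 0"
    have "positive_semidefinite dA (M x i)" "positive_semidefinite dB (N y j)"
      using M[OF *(1)] N[OF *(2)] *(3,4) by (auto simp: povm_def)
    note orth = compress_orthogonal[OF this a b \<phi>(1) c \<phi>(2) zero[OF *]]
    show "block_op r (compress dA a (M x i)) * block_op r (\<lambda>m n. compress dB b (N y j) n m) = 0 \<and>
        block_op r (\<lambda>m n. compress dB b (N y j) n m) * block_op r (compress dA a (M x i)) = 0"
      by (simp add: block_op_mult[OF r] orth block_op_zero)
  qed (rule endo_torsion2 endo_torsion3; assumption)+
  show False
    by (rule no_solution)
qed

theorem corollary2p5:
  shows "is_classical_value (11 / 12) \<and>
    quantum_value = 1 \<and>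
    \<not> (\<exists>dA dB \<rho> M N \<phi>.
        quantum_strategy dA dB \<rho> M N \<and>
        maximally_entangled dA dB \<phi> \<and>
        \<rho> = ketbra \<phi> \<and>
        winning_prob \<rho> M N = 1)"
  using classical_value quantum_value no_perfect_maximally_entangled by blast

end
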